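(* Let $P$ be a $\mathrm{TN}$-poset with a least element $\hat0$, and let $S$ be an infinite set of nonnegative integers containing $0$. If $Q$ is a finite $P$-positive poset, then $Q_S$ is $P_S$-positive.
   Context: All posets here have a least element $\hat0$. Quasi-rank. For a locally finite poset $P$, $\rho(x)=\max\{k:x_0<\cdots<x_k=x,\ x_i\in P\}$ (assumed finite) is the quasi-rank function and $\rho(P)=\sup_x\rho(x)\in\mathbb{N}\cup\{\infty\}$ the (quasi-)rank. Write $\langle x\rangle=\{z\in P:z\le x\}$. $P$ is quasi-rank uniform if for all $x,y$ with $\rho(x)=\rho(y)$ and all $0\le k\le\rho(x)$, $|\{z\in\langle x\rangle:\rho(z)=k\}|=|\{z\in\langle y\rangle:\rho(z)=k\}|$ (finite). Then $r_{n,k}=|\{z\in\langle x\rangle:\rho(z)=k\}|$ for any $x$ with $\rho(x)=n$, and $R(P)=(r_{n,k})_{n,k=0}^N$, $N=\rho(P)$. A quasi-rank uniform poset is a $\mathrm{TN}$-poset if all minors of $R(P)$ are nonnegative. For a poset $P$ with quasi-rank function $\rho$, $P_S=\{x\in P:\rho(x)\in S\}$ with the induced order (similarly $Q_S$, using the quasi-rank function of $Q$). If $P$ is a $\mathrm{TN}$-poset then so is $P_S$, so $P_S$-positivity makes sense. The polynomials $R_{n,k}(t)$. If $R=(r_{n,k})_{n,k=0}^N$ is a totally nonnegative lower triangular matrix with unit diagonal, there are a unique array of nonnegative numbers $(\lambda_{n,k})_{0\le k\le n<N}$ with the property that $\lambda_{n,k}=0$ implies $\lambda_{n+1,k}=0$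 (for $0\le k\le n<N-1$), and a unique array of monic polynomials $(R_{n,k}(t))_{0\le k\le n\le N}$, such that $R_{n,0}(t)=\sum_{k=0}^n r_{n,k}t^k$, $R_{n,n}(t)=t^n$, $t^k$ divides $R_{n,k}(t)$, and $R_{n+1,k}(t)=R_{n+1,k+1}(t)+\lambda_{n,k}R_{n,k}(t)$ for $0\le k\le n<N$. $P$-positivity. Let $P$ be a $\mathrm{TN}$-poset, with $R_{n,k}(t)$ the polynomials associated to $R(P)$. A quasi-rank uniform poset $Q$ with quasi-rank function $\nu$ is a combinatorial $P$-poset if $\sum_{x\le_Q y}t^{\nu(x)}=R_{m,0}(t)$, $m=\nu(y)$, for every $y\in Q$ (in particular the rank of $Q$ is at most that of $P$). A combinatorial $P$-poset $Q$ of rank $r$ is $P$-positive if $f_Q(t)=\sum_{x\in Q}t^{\nu(x)}=\sum_{k=0}^r h_kR_{r,k}(t)$ for some real numbers $h_k\ge0$. *)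

theory Defs
  imports
    "HOL-Library.Extended_Nat"
    "HOL-Computational_Algebra.Polynomial"
    "Jordan_Normal_Form.Determinant"
begin

text \<open>
  A poset is given by its (reflexive) order relation \<open>r\<close>; its underlying set is \<^term>\<open>Field r\<close>,
  its order is \<open>(x, y) \<in> r\<close>, and the principal ideal generated by \<open>x\<close> is
  \<^term>\<open>Order_Relation.under r x\<close>.
\<close>

definition has_least :: "'a rel \<Rightarrow> bool" where
  "has_least r \<longleftrightarrow> (\<exists>z\<in>Field r. \<forall>x\<in>Field r. (z, x) \<in> r)"

definition locally_finite_rel :: "'a rel \<Rightarrow> bool" where
  "locally_finite_rel r \<longleftrightarrow> (\<forall>x\<in>Field r. \<forall>y\<in>Field r. finite {z. (x, z) \<in> r \<and> (z, y) \<in> r})"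

definition chain_lengths :: "'a rel \<Rightarrow> 'a \<Rightarrow> nat set" where
  "chain_lengths r x =
     {k. \<exists>c :: nat \<Rightarrow> 'a. c k = x \<and> (\<forall>i\<le>k. c i \<in> Field r) \<and>
           (\<forall>i<k. (c i, c (Suc i)) \<in> r \<and> c i \<noteq> c (Suc i))}"

definition quasi_rank :: "'a rel \<Rightarrow> 'a \<Rightarrow> nat" where
  "quasi_rank r x = Max (chain_lengths r x)"

definition poset_rank :: "'a rel \<Rightarrow> enat" where
  "poset_rank r = (SUP x\<in>Field r. enat (quasi_rank r x))"

definition quasi_ranked_poset :: "'a rel \<Rightarrow> bool" where
  "quasi_ranked_poset r \<longleftrightarrow> Partial_order r \<and> has_least r \<and> locally_finite_rel r \<and>
     (\<forall>x\<in>Field r. finite (chain_lengths r x))"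

definition level_below :: "'a rel \<Rightarrow> 'a \<Rightarrow> nat \<Rightarrow> 'a set" where
  "level_below r x k = {z \<in> Order_Relation.under r x. quasi_rank r z = k}"

definition quasi_rank_uniform :: "'a rel \<Rightarrow> bool" where
  "quasi_rank_uniform r \<longleftrightarrow> quasi_ranked_poset r \<and>
     (\<forall>x\<in>Field r. \<forall>k\<le>quasi_rank r x. finite (level_below r x k)) \<and>
     (\<forall>x\<in>Field r. \<forall>y\<in>Field r. quasi_rank r x = quasi_rank r y \<longrightarrow>
        (\<forall>k\<le>quasi_rank r x. card (level_below r x k) = card (level_below r y k)))"

text \<open>
  The entries \<open>r\<^sub>n\<^sub>,\<^sub>k\<close> of the matrix \<open>R(P)\<close>. They are meaningful only for \<open>n, k \<le> poset_rank r\<close>;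
  every use below is guarded accordingly.
\<close>

definition rank_matrix :: "'a rel \<Rightarrow> nat \<Rightarrow> nat \<Rightarrow> real" where
  "rank_matrix r n k =
     real (card (level_below r (SOME x. x \<in> Field r \<and> quasi_rank r x = n) k))"

text \<open>
  All minors of \<open>(a\<^sub>n\<^sub>,\<^sub>k)\<close>, \<open>0 \<le> n, k \<le> N\<close>, are nonnegative; \<open>N\<close> may be infinite. The minor of
  size \<open>m\<close> uses the rows \<open>I 0 < \<dots> < I (m - 1)\<close> and the columns \<open>J 0 < \<dots> < J (m - 1)\<close>.
\<close>

definition totally_nonneg :: "enat \<Rightarrow> (nat \<Rightarrow> nat \<Rightarrow> real) \<Rightarrow> bool" where
  "totally_nonneg N a \<longleftrightarrow>
     (\<forall>m (I :: nat \<Rightarrow> nat) (J :: nat \<Rightarrow> nat).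
        strict_mono_on {..<m} I \<and> strict_mono_on {..<m} J \<and>
        (\<forall>i<m. enat (I i) \<le> N \<and> enat (J i) \<le> N) \<longrightarrow>
        det (mat m m (\<lambda>(i, j). a (I i) (J j))) \<ge> 0)"

definition TN_poset :: "'a rel \<Rightarrow> bool" where
  "TN_poset r \<longleftrightarrow> quasi_rank_uniform r \<and> totally_nonneg (poset_rank r) (rank_matrix r)"

definition resolves ::
  "enat \<Rightarrow> (nat \<Rightarrow> nat \<Rightarrow> real) \<Rightarrow> (nat \<Rightarrow> nat \<Rightarrow> real) \<Rightarrow> (nat \<Rightarrow> nat \<Rightarrow> real poly) \<Rightarrow> bool" where
  "resolves N a l R \<longleftrightarrow>
     (\<forall>n k. k \<le> n \<and> enat n < N \<longrightarrow> l n k \<ge> 0) \<and>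
     (\<forall>n k. k \<le> n \<and> enat (Suc n) < N \<and> l n k = 0 \<longrightarrow> l (Suc n) k = 0) \<and>
     (\<forall>n k. k \<le> n \<and> enat n \<le> N \<longrightarrow> lead_coeff (R n k) = 1 \<and> monom 1 k dvd R n k) \<and>
     (\<forall>n. enat n \<le> N \<longrightarrow> R n 0 = (\<Sum>k\<le>n. monom (a n k) k) \<and> R n n = monom 1 n) \<and>
     (\<forall>n k. k \<le> n \<and> enat n < N \<longrightarrow> R (Suc n) k = R (Suc n) (Suc k) + smult (l n k) (R n k))"

text \<open>
  The array \<open>R\<^sub>n\<^sub>,\<^sub>k\<close> is indexed by \<open>0 \<le> k \<le> n \<le> N\<close>. Setting it to \<open>0\<close> outside that range makes
  it unique as a function on all pairs of naturals, as required by the definite description.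
\<close>

definition R_polys :: "enat \<Rightarrow> (nat \<Rightarrow> nat \<Rightarrow> real) \<Rightarrow> nat \<Rightarrow> nat \<Rightarrow> real poly" where
  "R_polys N a =
     (THE R. (\<exists>l. resolves N a l R) \<and> (\<forall>n k. \<not> (k \<le> n \<and> enat n \<le> N) \<longrightarrow> R n k = 0))"

abbreviation poset_polys :: "'a rel \<Rightarrow> nat \<Rightarrow> nat \<Rightarrow> real poly" where
  "poset_polys P \<equiv> R_polys (poset_rank P) (rank_matrix P)"

text \<open>
  The standing assumption that \<open>P\<close> is a TN-poset is part of the following notion, so asserting
  \<open>P\<close>-positivity also asserts that it makes sense.
\<close>

definition combinatorial_poset :: "'a rel \<Rightarrow> 'b rel \<Rightarrow> bool" where
  "combinatorial_poset P Q \<longleftrightarrow> TN_poset P \<and> quasi_rank_uniform Q \<and> poset_rank Q \<le> poset_rank P \<and>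
     (\<forall>y\<in>Field Q. (\<Sum>x\<in>Order_Relation.under Q y. monom 1 (quasi_rank Q x))
                   = poset_polys P (quasi_rank Q y) 0)"

definition f_poly :: "'b rel \<Rightarrow> real poly" where
  "f_poly Q = (\<Sum>x\<in>Field Q. monom 1 (quasi_rank Q x))"

text \<open>Finiteness of \<open>Q\<close> is required since otherwise \<open>f\<^sub>Q\<close> is not a polynomial (and \<^const>\<open>f_poly\<close>
  would be \<open>0\<close>).\<close>

definition poset_positive :: "'a rel \<Rightarrow> 'b rel \<Rightarrow> bool" where
  "poset_positive P Q \<longleftrightarrow> combinatorial_poset P Q \<and> finite (Field Q) \<and>
     (\<exists>d h. poset_rank Q = enat d \<and> (\<forall>k\<le>d. h k \<ge> (0 :: real)) \<and>
        f_poly Q = (\<Sum>k\<le>d. smult (h k) (poset_polys P d k)))"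

definition rank_selected :: "'a rel \<Rightarrow> nat set \<Rightarrow> 'a rel" where
  "rank_selected r S = Restr r {x \<in> Field r. quasi_rank r x \<in> S}"

end

theory Submission
  imports Defs
begin

text \<open>
  The recurrence for the polynomials \<open>R\<^sub>n\<^sub>,\<^sub>k\<close> is Neville elimination on the lower unitriangular matrix
  \<open>R(P)\<close>: the array \<open>(R\<^sub>n\<^sub>,\<^sub>k)\<close>, \<open>n \<ge> k\<close>, is what remains after \<open>k\<close> columns have been cleared.
  Elimination preserves total nonnegativity and produces nonnegative multipliers. Conversely, undoing
  the elimination with arbitrary nonnegative multipliers yields a totally nonnegative matrix.

  Therefore \<open>f = \<Sum> h\<^sub>k R\<^sub>d\<^sub>,\<^sub>k\<close> with all \<open>h\<^sub>k \<ge> 0\<close> makes the matrix totally nonnegative that arises from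
  \<open>R(P)\<close>, truncated at rank \<open>d\<close>, by appending \<open>f + t\<^sup>d\<^sup>+\<^sup>1\<close> as a further row: the \<open>h\<^sub>k\<close> are
  its last multipliers. Selecting the rows and columns in \<open>S\<close> together with the appended
  ones keeps total nonnegativity, and the last multipliers of the new matrix are the coefficients of
  \<open>f\<close> of the rank-selected poset.
\<close>

subsection \<open>Determinants of functions\<close>

text \<open>Stated for functions, so that replacing a row is a function update and a minor is a
  composition with index maps.\<close>

definition det_fun :: "nat \<Rightarrow> (nat \<Rightarrow> nat \<Rightarrow> real) \<Rightarrow> real" where
  "det_fun m F = det (mat m m (\<lambda>(i, j). F i j))"

lemma det_fun_cong: "(\<And>i j. i < m \<Longrightarrow> j < m \<Longrightarrow> F i j = G i j) \<Longrightarrow> det_fun m F = det_fun m G"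
  unfolding det_fun_def by (rule arg_cong[where f = det]) (auto intro!: eq_matI)

lemma det_fun_0 [simp]: "det_fun 0 F = 1"
  by (simp add: det_fun_def)

lemma cofactor_det_fun:
  assumes "i < Suc m" "j < Suc m"
  shows "cofactor (mat (Suc m) (Suc m) (\<lambda>(i, j). F i j)) i j
    = (-1) ^ (i + j) * det_fun m (\<lambda>i' j'. F (insert_index i i') (insert_index j j'))"
proof -
  have "mat_delete (mat (Suc m) (Suc m) (\<lambda>(i, j). F i j)) i j
      = mat m m (\<lambda>(i', j'). F (insert_index i i') (insert_index j j'))"
    using assms by (intro eq_matI) (auto simp: mat_delete_def insert_index_def)
  then show ?thesis
    by (simp add: cofactor_def det_fun_def)
qed

lemma det_fun_expand_row:
  assumes "i < Suc m"
  shows "det_fun (Suc m) F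
    = (\<Sum>j<Suc m. F i j * ((-1) ^ (i + j) * det_fun m (\<lambda>i' j'. F (insert_index i i') (insert_index j j'))))"
proof -
  let ?M = "mat (Suc m) (Suc m) (\<lambda>(i, j). F i j)"
  have "det_fun (Suc m) F = (\<Sum>j<Suc m. ?M $$ (i, j) * cofactor ?M i j)"
    unfolding det_fun_def by (rule laplace_expansion_row) (use assms in auto)
  also have "\<dots> = (\<Sum>j<Suc m. F i j * ((-1) ^ (i + j) * det_fun m (\<lambda>i' j'. F (insert_index i i') (insert_index j j'))))"
    using assms by (intro sum.cong) (auto simp: cofactor_det_fun)
  finally show ?thesis .
qed

lemma det_fun_expand_col:
  assumes "j < Suc m"
  shows "det_fun (Suc m) F
    = (\<Sum>i<Suc m. F i j * ((-1) ^ (i + j) * det_fun m (\<lambda>i' j'. F (insert_index i i') (insert_index j j'))))"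
proof -
  let ?M = "mat (Suc m) (Suc m) (\<lambda>(i, j). F i j)"
  have "det_fun (Suc m) F = (\<Sum>i<Suc m. ?M $$ (i, j) * cofactor ?M i j)"
    unfolding det_fun_def by (rule laplace_expansion_column) (use assms in auto)
  also have "\<dots> = (\<Sum>i<Suc m. F i j * ((-1) ^ (i + j) * det_fun m (\<lambda>i' j'. F (insert_index i i') (insert_index j j'))))"
    using assms by (intro sum.cong) (auto simp: cofactor_det_fun)
  finally show ?thesis .
qed

lemma det_fun_identical_rows:
  assumes "i < m" "l < m" "i \<noteq> l" "\<And>j. j < m \<Longrightarrow> F i j = F l j"
  shows "det_fun m F = 0"
  unfolding det_fun_def using assms
  by (intro det_identical_rows[where i = i and j = l and n = m]) (auto intro!: eq_vecI)

section \<open>Linearity in one row, Cramer's rule and a Pluecker relation\<close>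

lemma det_fun_row_update:
  assumes "i < Suc m"
  shows "det_fun (Suc m) (F(i := v))
    = (\<Sum>j<Suc m. v j * ((-1) ^ (i + j) * det_fun m (\<lambda>i' j'. F (insert_index i i') (insert_index j j'))))"
  using assms by (subst det_fun_expand_row[OF assms]) simp

lemma det_fun_row_sum:
  assumes "i < m"
  shows "det_fun m (F(i := (\<lambda>j. \<Sum>l\<in>L. c l * u l j))) = (\<Sum>l\<in>L. c l * det_fun m (F(i := u l)))"
proof -
  obtain n where m: "m = Suc n" using assms by (cases m) auto
  have *: "i < Suc n" using assms m by simp
  show ?thesis
    unfolding m det_fun_row_update[OF *] sum_distrib_left sum_distrib_right
    by (subst sum.swap) (simp add: mult.assoc)
qed

lemma det_fun_row_add:
  assumes "i < m"
  shows "det_fun m (F(i := (\<lambda>j. u j + c * v j))) = det_fun m (F(i := u)) + c * det_fun m (F(i := v))"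
proof -
  obtain n where m: "m = Suc n" using assms by (cases m) auto
  have *: "i < Suc n" using assms m by simp
  show ?thesis
    unfolding m det_fun_row_update[OF *] sum_distrib_left sum.distrib[symmetric]
    by (simp add: algebra_simps)
qed

lemma det_fun_row_unit:
  assumes "i < Suc m" "j < Suc m"
  shows "det_fun (Suc m) (F(i := (\<lambda>c. if c = j then 1 else 0)))
    = (-1) ^ (i + j) * det_fun m (\<lambda>i' j'. F (insert_index i i') (insert_index j j'))"
  using assms(2) unfolding det_fun_row_update[OF assms(1)]
  by (subst sum.remove[of _ j]) (auto intro!: sum.neutral)

text \<open>Comes from \<open>adj F * F = det F * 1\<close>: after multiplication by the
  determinant, any row \<open>v\<close> is a combination of the rows of \<open>F\<close>, even for
  singular \<open>F\<close>.\<close>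

lemma det_fun_cramer:
  assumes "j < m"
  shows "det_fun m F * v j = (\<Sum>l<m. det_fun m (F(l := v)) * F l j)"
proof -
  obtain n where m: "m = Suc n" using assms by (cases m) auto
  let ?M = "mat m m (\<lambda>(i, j). F i j)"
  let ?C = "\<lambda>l i. (-1) ^ (l + i) * det_fun n (\<lambda>i' j'. F (insert_index l i') (insert_index i j'))"
  \<comment> \<open>\<open>?C l i\<close> is the entry \<open>(i, l)\<close> of the
    adjugate.\<close>
  have C: "(\<Sum>l<m. ?C l i * F l j) = (if i = j then det_fun m F else 0)" if "i < m" for i
  proof -
    have "(adj_mat ?M * ?M) $$ (i, j) = (det ?M \<cdot>\<^sub>m 1\<^sub>m m) $$ (i, j)"
      by (subst adj_mat(3)[where n = m]) auto
    moreover have "(adj_mat ?M * ?M) $$ (i, j) = (\<Sum>l<m. ?C l i * F l j)"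
      using that assms unfolding m
      by (auto simp: adj_mat_def scalar_prod_def cofactor_det_fun atLeast0LessThan intro!: sum.cong)
    ultimately show ?thesis
      using that assms by (auto simp: det_fun_def)
  qed
  have "(\<Sum>l<m. det_fun m (F(l := v)) * F l j) = (\<Sum>l<m. \<Sum>i<m. v i * ?C l i * F l j)"
    unfolding m by (intro sum.cong refl) (simp add: det_fun_row_update sum_distrib_right del: sum.lessThan_Suc)
  also have "\<dots> = (\<Sum>i<m. v i * (\<Sum>l<m. ?C l i * F l j))"
    by (subst sum.swap) (simp add: sum_distrib_left mult.assoc)
  also have "\<dots> = (\<Sum>i<m. if i = j then v j * det_fun m F else 0)"
    by (intro sum.cong refl) (use C in auto)
  also have "\<dots> = det_fun m F * v j"
    using assms by simp
  finally show ?thesis ..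
qed

text \<open>By Cramer's rule, \<open>det F * q\<close> is a combination of the rows of
  \<open>F\<close>. Once it is substituted for row \<open>i\<close> of \<open>F(r := w)\<close>,
  each row of \<open>F\<close> other than rows \<open>r\<close> and \<open>i\<close> occurs twice
  and contributes nothing, which leaves two terms.\<close>

lemma det_fun_pluecker:
  assumes "r < m" "i < m" "r \<noteq> i"
  shows "det_fun m F * det_fun m (F(r := w, i := q))
    = det_fun m (F(r := q)) * det_fun m (F(r := w, i := F r)) + det_fun m (F(i := q)) * det_fun m (F(r := w))"
proof -
  let ?G = "F(r := w)"
  \<comment> \<open>The one-term sum moves the scalar into row \<open>i\<close>.\<close>
  have "det_fun m F * det_fun m (?G(i := q)) = det_fun m (?G(i := (\<lambda>j. \<Sum>l\<in>{()}. det_fun m F * q j)))"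
    using det_fun_row_sum[OF assms(2), where F = ?G and L = "{()}" and c = "\<lambda>_. det_fun m F" and u = "\<lambda>_. q"] by simp
  also have "\<dots> = det_fun m (?G(i := (\<lambda>j. \<Sum>l<m. det_fun m (F(l := q)) * F l j)))"
    by (rule det_fun_cong) (auto simp: det_fun_cramer)
  also have "\<dots> = (\<Sum>l<m. det_fun m (F(l := q)) * det_fun m (?G(i := F l)))"
    by (rule det_fun_row_sum[OF assms(2)])
  also have "\<dots> = (\<Sum>l\<in>{r, i}. det_fun m (F(l := q)) * det_fun m (?G(i := F l)))"
  proof (rule sum.mono_neutral_right)
    show "\<forall>l\<in>{..<m} - {r, i}. det_fun m (F(l := q)) * det_fun m (?G(i := F l)) = 0"
    proof
      fix l assume "l \<in> {..<m} - {r, i}"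
      then have "det_fun m (?G(i := F l)) = 0"
        using assms(2) by (intro det_fun_identical_rows[of i m l]) auto
      then show "det_fun m (F(l := q)) * det_fun m (?G(i := F l)) = 0"
        by simp
    qed
  qed (use assms in auto)
  also have "\<dots> = det_fun m (F(r := q)) * det_fun m (?G(i := F r)) + det_fun m (F(i := q)) * det_fun m (?G(i := F i))"
    using assms(3) by simp
  also have "?G(i := F i) = ?G"
    using assms(3) by auto
  finally show ?thesis .
qed


lemma det_fun_1 [simp]: "det_fun (Suc 0) F = F 0 0"
  by (simp add: det_fun_expand_row[of 0])

lemma det_fun_2: "det_fun (Suc (Suc 0)) F = F 0 0 * F 1 1 - F 0 1 * F 1 0"
  by (simp add: det_fun_expand_row[of 0] insert_index_def)

subsection \<open>Totally nonnegative arrays\<close>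

text \<open>Row and column sets are kept apart because elimination treats finitely many rows at a
  time while the columns may be infinite in number.\<close>

definition tn_on :: "nat set \<Rightarrow> nat set \<Rightarrow> (nat \<Rightarrow> nat \<Rightarrow> real) \<Rightarrow> bool" where
  "tn_on U V a \<longleftrightarrow> (\<forall>m I J. strict_mono_on {..<m} I \<and> strict_mono_on {..<m} J \<and>
     I ` {..<m} \<subseteq> U \<and> J ` {..<m} \<subseteq> V \<longrightarrow> 0 \<le> det_fun m (\<lambda>i j. a (I i) (J j)))"

lemma tn_onI:
  assumes "\<And>m I J. \<lbrakk>strict_mono_on {..<m} I; strict_mono_on {..<m} J;
    \<And>i. i < m \<Longrightarrow> I i \<in> U; \<And>j. j < m \<Longrightarrow> J j \<in> V\<rbrakk> \<Longrightarrow> 0 \<le> det_fun m (\<lambda>i j. a (I i) (J j))"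
  shows "tn_on U V a"
  unfolding tn_on_def using assms by (auto simp: image_subset_iff)

lemma tn_onD:
  assumes "tn_on U V a" "strict_mono_on {..<m} I" "strict_mono_on {..<m} J"
    "\<And>i. i < m \<Longrightarrow> I i \<in> U" "\<And>j. j < m \<Longrightarrow> J j \<in> V"
  shows "0 \<le> det_fun m (\<lambda>i j. a (I i) (J j))"
  using assms unfolding tn_on_def by (auto simp: image_subset_iff)

lemma tn_on_subset: "tn_on U V a \<Longrightarrow> U' \<subseteq> U \<Longrightarrow> V' \<subseteq> V \<Longrightarrow> tn_on U' V' a"
  unfolding tn_on_def by (meson subset_trans)

lemma tn_on_cong:
  assumes "\<And>n j. n \<in> U \<Longrightarrow> j \<in> V \<Longrightarrow> a n j = b n j"
  shows "tn_on U V a = tn_on U V b"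
proof -
  have "det_fun m (\<lambda>i j. a (I i) (J j)) = det_fun m (\<lambda>i j. b (I i) (J j))"
    if "I ` {..<m} \<subseteq> U" "J ` {..<m} \<subseteq> V" for m I J
    using that by (intro det_fun_cong assms) auto
  then show ?thesis
    unfolding tn_on_def by simp
qed

lemma tn_on_entry_nonneg:
  assumes "tn_on U V a" "n \<in> U" "j \<in> V"
  shows "0 \<le> a n j"
proof -
  have "0 \<le> det_fun (Suc 0) (\<lambda>_ _. a n j)"
    by (rule tn_onD[OF assms(1)]) (use assms in \<open>auto simp: strict_mono_on_def\<close>)
  then show ?thesis by simp
qed

lemma tn_on_minor2:
  assumes "tn_on U V a" "n \<in> U" "n' \<in> U" "j \<in> V" "j' \<in> V" "n < n'" "j < j'"
  shows "a n j' * a n' j \<le> a n j * a n' j'"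
proof -
  have "0 \<le> det_fun (Suc (Suc 0)) (\<lambda>i l. a (if i = 0 then n else n') (if l = 0 then j else j'))"
    by (rule tn_onD[OF assms(1)]) (use assms in \<open>auto simp: strict_mono_on_def\<close>)
  then show ?thesis by (simp add: det_fun_2)
qed

text \<open>A strictly increasing choice of rows and columns turns minors into minors; rank
  selection acts on matrices in this way.\<close>

lemma tn_on_comp:
  assumes "tn_on U V a" "strict_mono_on X f" "strict_mono_on Y g" "f ` X \<subseteq> U" "g ` Y \<subseteq> V"
  shows "tn_on X Y (\<lambda>n j. a (f n) (g j))"
proof (rule tn_onI)
  fix m and I J :: "nat \<Rightarrow> nat"
  assume *: "strict_mono_on {..<m} I" "strict_mono_on {..<m} J"
    "\<And>i. i < m \<Longrightarrow> I i \<in> X" "\<And>j. j < m \<Longrightarrow> J j \<in> Y"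
  have "strict_mono_on {..<m} (f \<circ> I)" "strict_mono_on {..<m} (g \<circ> J)"
    using * assms(2,3) by (auto simp: strict_mono_on_def)
  from tn_onD[OF assms(1) this] show "0 \<le> det_fun m (\<lambda>i j. a (f (I i)) (g (J j)))"
    using *(3,4) assms(4,5) by (auto simp: image_subset_iff)
qed

section \<open>Row operations that preserve total nonnegativity\<close>

lemma tn_on_mono_rows:
  assumes "tn_on U V a" "mono_on {..<m} I" "strict_mono_on {..<m} J"
    "\<And>i. i < m \<Longrightarrow> I i \<in> U" "\<And>j. j < m \<Longrightarrow> J j \<in> V"
  shows "0 \<le> det_fun m (\<lambda>i j. a (I i) (J j))"
proof (cases "strict_mono_on {..<m} I")
  case True
  then show ?thesis using tn_onD assms by blast
next
  case False
  then obtain i l where "i < m" "l < m" "i < l" "\<not> I i < I l"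
    by (auto simp: strict_mono_on_def)
  moreover from this have "I i = I l"
    using mono_onD[OF assms(2), of i l] by auto
  ultimately have "det_fun m (\<lambda>i j. a (I i) (J j)) = 0"
    by (intro det_fun_identical_rows[of i m l]) auto
  then show ?thesis by simp
qed

text \<open>A minor through row \<open>q\<close> splits by linearity into itself and a multiple of
  the one with \<open>p\<close> in place of \<open>q\<close>; all other minors are unchanged. The
  index map \<open>I(i := p)\<close> may repeat a row or be out of order, so the sign of the sum is
  left to each use.\<close>

lemma tn_on_row_comb:
  assumes "tn_on U V a"
    and "\<And>m I J i. \<lbrakk>strict_mono_on {..<m} I; strict_mono_on {..<m} J; \<And>i. i < m \<Longrightarrow> I i \<in> U;
      \<And>j. j < m \<Longrightarrow> J j \<in> V; i < m; I i = q\<rbrakk> \<Longrightarrow>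
      0 \<le> det_fun m (\<lambda>i j. a (I i) (J j)) + c * det_fun m (\<lambda>l j. a ((I(i := p)) l) (J j))"
  shows "tn_on U V (a(q := (\<lambda>j. a q j + c * a p j)))"
proof (rule tn_onI)
  fix m and I J :: "nat \<Rightarrow> nat"
  let ?b = "a(q := (\<lambda>j. a q j + c * a p j))"
  assume *: "strict_mono_on {..<m} I" "strict_mono_on {..<m} J"
    "\<And>i. i < m \<Longrightarrow> I i \<in> U" "\<And>j. j < m \<Longrightarrow> J j \<in> V"
  show "0 \<le> det_fun m (\<lambda>i j. ?b (I i) (J j))"
  proof (cases "\<exists>i<m. I i = q")
    case False
    then have "det_fun m (\<lambda>i j. ?b (I i) (J j)) = det_fun m (\<lambda>i j. a (I i) (J j))"
      by (intro det_fun_cong) auto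
    then show ?thesis using tn_onD[OF assms(1)] * by simp
  next
    case True
    then obtain i where i: "i < m" "I i = q" by blast
    have inj: "I l \<noteq> q" if "l < m" "l \<noteq> i" for l
      using strict_mono_on_imp_inj_on[OF *(1)] that i by (auto simp: inj_on_def)
    let ?F = "\<lambda>i j. a (I i) (J j)"
    have "det_fun m (\<lambda>i j. ?b (I i) (J j)) = det_fun m (?F(i := (\<lambda>j. a q (J j) + c * a p (J j))))"
      using inj i by (intro det_fun_cong) auto
    also have "\<dots> = det_fun m (?F(i := (\<lambda>j. a q (J j)))) + c * det_fun m (?F(i := (\<lambda>j. a p (J j))))"
      by (rule det_fun_row_add[OF i(1)])
    also have "det_fun m (?F(i := (\<lambda>j. a q (J j)))) = det_fun m ?F"
      using i by (intro det_fun_cong) auto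
    also have "det_fun m (?F(i := (\<lambda>j. a p (J j)))) = det_fun m (\<lambda>l j. a ((I(i := p)) l) (J j))"
      by (intro det_fun_cong) auto
    finally show ?thesis using assms(2)[OF * i] by simp
  qed
qed

text \<open>Since \<open>p\<close> and \<open>Suc p\<close> are adjacent, putting \<open>p\<close>
  in place of \<open>Suc p\<close> keeps a row selection weakly increasing, so the second minor is
  nonnegative or has a repeated row.\<close>

lemma tn_on_add_row:
  assumes "tn_on U V a" "p \<in> U" "0 \<le> c"
  shows "tn_on U V (a(Suc p := (\<lambda>j. a (Suc p) j + c * a p j)))"
proof (rule tn_on_row_comb[OF assms(1)])
  fix m i and I J :: "nat \<Rightarrow> nat"
  assume *: "strict_mono_on {..<m} I" "strict_mono_on {..<m} J"
    "\<And>i. i < m \<Longrightarrow> I i \<in> U" "\<And>j. j < m \<Longrightarrow> J j \<in> V" and i: "i < m" "I i = Suc p"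
  have "mono_on {..<m} (I(i := p))"
  proof (rule mono_onI)
    fix r s assume rs: "r \<in> {..<m}" "s \<in> {..<m}" "r \<le> s"
    show "(I(i := p)) r \<le> (I(i := p)) s"
      using rs strict_mono_onD[OF *(1), of r s] strict_mono_onD[OF *(1), of i s] i
      by (cases "r = s") auto
  qed
  then have "0 \<le> det_fun m (\<lambda>l j. a ((I(i := p)) l) (J j))"
    by (rule tn_on_mono_rows[OF assms(1)]) (use * assms(2) in auto)
  moreover have "0 \<le> det_fun m (\<lambda>i j. a (I i) (J j))"
    using tn_onD[OF assms(1)] * by simp
  ultimately show "0 \<le> det_fun m (\<lambda>i j. a (I i) (J j)) + c * det_fun m (\<lambda>l j. a ((I(i := p)) l) (J j))"
    using assms(3) by simp
qed

text \<open>The array is block diagonal with first block \<open>1\<close>. A minor through only one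
  of row \<open>k\<close> and column \<open>k\<close> has a zero line; a minor through both reduces
  to one on \<open>U\<close> and \<open>V\<close>.\<close>

lemma tn_on_insert_unit:
  assumes "tn_on U V a" "\<And>u. u \<in> U \<Longrightarrow> k < u" "\<And>v. v \<in> V \<Longrightarrow> k < v"
    and "a k k = 1" "\<And>v. v \<in> V \<Longrightarrow> a k v = 0" "\<And>u. u \<in> U \<Longrightarrow> a u k = 0"
  shows "tn_on (insert k U) (insert k V) a"
proof (rule tn_onI)
  fix m and I J :: "nat \<Rightarrow> nat"
  assume *: "strict_mono_on {..<m} I" "strict_mono_on {..<m} J"
    "\<And>i. i < m \<Longrightarrow> I i \<in> insert k U" "\<And>j. j < m \<Longrightarrow> J j \<in> insert k V"
  have I: "I i \<in> U" if "i < m" "0 < i" for i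
    using strict_mono_onD[OF *(1), of 0 i] *(3)[of i] *(3)[of 0] assms(2)[of "I 0"] that by auto
  have J: "J i \<in> V" if "i < m" "0 < i" for i
    using strict_mono_onD[OF *(2), of 0 i] *(4)[of i] *(4)[of 0] assms(3)[of "J 0"] that by auto
  show "0 \<le> det_fun m (\<lambda>i j. a (I i) (J j))"
  proof (cases m)
    case (Suc n)
    consider "I 0 = k" "J 0 = k" | "I 0 = k" "J 0 \<in> V" | "I 0 \<in> U" "J 0 = k" | "I 0 \<in> U" "J 0 \<in> V"
      using *(3,4) Suc by blast
    then show ?thesis
    proof cases
      case 1
      have "det_fun m (\<lambda>i j. a (I i) (J j)) = det_fun n (\<lambda>i j. a (I (Suc i)) (J (Suc j)))"
        unfolding Suc
        by (subst det_fun_expand_row[of 0], simp, subst sum.remove[of _ 0])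
          (use 1 J assms(4,5) Suc in \<open>auto simp: insert_index_def intro!: sum.neutral\<close>)
      moreover have "0 \<le> det_fun n (\<lambda>i j. a ((I \<circ> Suc) i) ((J \<circ> Suc) j))"
        using *(1,2) I J Suc by (intro tn_onD[OF assms(1)]) (auto simp: strict_mono_on_def)
      ultimately show ?thesis by simp
    next
      case 2
      then have J': "J j \<in> V" if "j < Suc n" for j
        using J[of j] that Suc by (cases "j = 0") auto
      have "det_fun m (\<lambda>i j. a (I i) (J j)) = 0"
        unfolding Suc by (subst det_fun_expand_row[of 0]) (use J' assms(5) 2 in \<open>auto intro!: sum.neutral\<close>)
      then show ?thesis by simp
    next
      case 3
      then have I': "I j \<in> U" if "j < Suc n" for j
        using I[of j] that Suc by (cases "j = 0") auto
      have "det_fun m (\<lambda>i j. a (I i) (J j)) = 0"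
        unfolding Suc by (subst det_fun_expand_col[of 0]) (use I' assms(6) 3 in \<open>auto intro!: sum.neutral\<close>)
      then show ?thesis by simp
    next
      case 4
      then have I': "I j \<in> U" and J': "J j \<in> V" if "j < m" for j
        using I[of j] J[of j] that by (cases "j = 0"; simp)+
      show ?thesis
        using * I' J' by (intro tn_onD[OF assms(1)]) auto
    qed
  qed simp
qed

subsection \<open>Neville elimination\<close>

lemma strict_mono_on_delete:
  assumes "strict_mono_on {..<Suc m} (I :: nat \<Rightarrow> nat)"
  shows "strict_mono_on {..<m} (\<lambda>i. I (insert_index r i))"
  using assms by (auto simp: strict_mono_on_def insert_index_def)

text \<open>
  Induction on the number \<open>s\<close> of selected rows above row \<open>p + 1\<close>. The Pluecker relation removes
  the last of these rows together with some column \<open>c\<close>; choosing \<open>c\<close> by Laplace expansion avoids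
  division by a vanishing minor. For \<open>s = 0\<close>, the claim is that the minor with the additional row \<open>p\<close> and
  the additional column \<open>k\<close> is nonnegative.
\<close>
lemma tn_on_elimination_minor:
  assumes tn_on: "tn_on U V a"
    and k: "k \<in> V" "\<And>v. v \<in> V \<Longrightarrow> k \<le> v" and p: "p \<in> U"
    and zero: "\<And>n. n \<in> U \<Longrightarrow> Suc p < n \<Longrightarrow> a n k = 0"
    and I: "strict_mono_on {..<m} I" "\<And>i. i < m \<Longrightarrow> I i \<in> U"
    and J: "strict_mono_on {..<m} J" "\<And>j. j < m \<Longrightarrow> J j \<in> V"
    and s: "s < m" "I s = Suc p" and no: "\<And>i. i < m \<Longrightarrow> I i \<noteq> p"
  shows "a (Suc p) k * det_fun m (\<lambda>i j. a ((I(s := p)) i) (J j)) \<le> a p k * det_fun m (\<lambda>i j. a (I i) (J j))"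
  using I J s no
proof (induction s arbitrary: m I J)
  case 0
  note I = 0(1,2) and J = 0(3,4) and s = 0(5,6)
  obtain n where m: "m = Suc n" using s by (cases m) auto
  have later: "Suc p < I i" if "0 < i" "i < m" for i
    using strict_mono_onD[OF I(1), of 0 i] that s by simp
  have van: "a (I i) k = 0" if "0 < i" "i < m" for i
    using later[OF that] I(2)[of i] that zero by simp
  show ?case
  proof (cases "J 0 = k")
    \<comment> \<open>Both minors have at most their top entry nonzero in the first column, with the
      same cofactor, so equality holds.\<close>
    case True
    have "det_fun m (\<lambda>i j. a (I' i) (J j)) = a (I' 0) k * det_fun n (\<lambda>i j. a (I (Suc i)) (J (Suc j)))"
      if "\<And>i. 0 < i \<Longrightarrow> I' i = I i" for I'
      unfolding m
      by (subst det_fun_expand_col[of 0], simp, subst sum.remove[of _ 0])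
        (use True van m that in \<open>auto simp: insert_index_def intro!: sum.neutral\<close>)
    from this[of I] this[of "I(0 := p)"] show ?thesis
      using s by simp
  next
    case False
    then have kJ: "k < J j" if "j < m" for j
      using k(2)[of "J j"] k(2)[of "J 0"] J strict_mono_onD[OF J(1), of 0 j] that s
      by (cases "j = 0") fastforce+
    let ?I = "\<lambda>i. case i of 0 \<Rightarrow> p | Suc i \<Rightarrow> I i" and ?J = "\<lambda>j. case j of 0 \<Rightarrow> k | Suc j \<Rightarrow> J j"
    have pI: "p < I i" if "i < m" for i
      using that s later[of i] by (cases "i = 0") auto
    have "0 \<le> det_fun (Suc m) (\<lambda>i j. a (?I i) (?J j))"
    proof (rule tn_onD[OF tn_on])
      show "strict_mono_on {..<Suc m} ?I" "strict_mono_on {..<Suc m} ?J"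
        using I J pI kJ by (auto simp: strict_mono_on_def split: nat.splits)
    qed (use I J p k in \<open>auto split: nat.splits\<close>)
    \<comment> \<open>Column \<open>k\<close> vanishes below row \<open>Suc p\<close>, so only rows
      \<open>p\<close> and \<open>Suc p\<close> contribute; their cofactors are the two minors to be
      compared.\<close>
    also have "det_fun (Suc m) (\<lambda>i j. a (?I i) (?J j))
      = (\<Sum>i\<in>{0, Suc 0}. a (?I i) k * ((-1) ^ i * det_fun m (\<lambda>i' j. a (?I (insert_index i i')) (J j))))"
      by (subst det_fun_expand_col[of 0], simp, rule sum.mono_neutral_cong_right)
        (use m van in \<open>auto split: nat.splits\<close>)
    finally have "0 \<le> a p k * det_fun m (\<lambda>i' j. a (?I (insert_index 0 i')) (J j))
        - a (Suc p) k * det_fun m (\<lambda>i' j. a (?I (insert_index (Suc 0) i')) (J j))"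
      using s by simp
    moreover have "det_fun m (\<lambda>i' j. a (?I (insert_index 0 i')) (J j)) = det_fun m (\<lambda>i j. a (I i) (J j))"
      by (rule det_fun_cong) (auto simp: insert_index_def)
    moreover have "det_fun m (\<lambda>i' j. a (?I (insert_index (Suc 0) i')) (J j))
        = det_fun m (\<lambda>i j. a ((I(0 := p)) i) (J j))"
      by (rule det_fun_cong) (auto simp: insert_index_def split: nat.splits)
    ultimately show ?thesis by simp
  qed
next
  case (Suc r)
  note I = Suc.prems(1,2) and J = Suc.prems(3,4) and s = Suc.prems(5,6) and no = Suc.prems(7)
  obtain n where m: "m = Suc n" using s by (cases m) auto
  have earlier: "I i < p" if "i \<le> r" for i
    using strict_mono_onD[OF I(1), of i "Suc r"] that s no[of i] by simp
  have later: "Suc p < I i" if "Suc r < i" "i < m" for i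
    using strict_mono_onD[OF I(1), of "Suc r" i] that s by simp
  let ?F = "\<lambda>i j. a (I i) (J j)" and ?q = "\<lambda>j. a p (J j)"
  let ?del = "\<lambda>H c. det_fun n (\<lambda>i j. H (insert_index r i) (insert_index c j))"
  let ?X = "det_fun m ?F" and ?X' = "det_fun m (\<lambda>i j. a ((I(Suc r := p)) i) (J j))"
  have X': "?X' = det_fun m (?F(Suc r := ?q))"
    by (rule det_fun_cong) auto
  have a0: "0 \<le> a p k" "0 \<le> a (Suc p) k"
    using tn_on_entry_nonneg[OF tn_on] p k I(2)[of "Suc r"] s by auto
  have X0: "0 \<le> ?X"
    using tn_onD[OF tn_on] I J by simp
  have mI': "strict_mono_on {..<m} (I(Suc r := p))"
  proof (rule strict_mono_onI)
    fix i l assume "i \<in> {..<m}" "l \<in> {..<m}" "i < l"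
    then show "(I(Suc r := p)) i < (I(Suc r := p)) l"
      using earlier[of i] later[of l] strict_mono_onD[OF I(1), of i l] by auto
  qed
  have X'0: "0 \<le> ?X'"
    by (rule tn_onD[OF tn_on mI' J(1)]) (use I J p in auto)
  show ?case
  proof (cases "?X' = 0")
    case True
    then show ?thesis using a0 X0 by simp
  next
    case False
    have "?X' = (\<Sum>c<Suc n. (?F(Suc r := ?q)) r c * ((-1) ^ (r + c) * ?del (?F(Suc r := ?q)) c))"
      unfolding X' unfolding m by (rule det_fun_expand_row) (use s m in simp)
    with False obtain c where c: "c < Suc n" "?del (?F(Suc r := ?q)) c \<noteq> 0"
      by (metis (no_types, lifting) lessThan_iff mult_zero_right sum.neutral)
    let ?I = "\<lambda>i. I (insert_index r i)" and ?J = "\<lambda>j. J (insert_index c j)"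
    let ?Y = "det_fun n (\<lambda>i j. a (?I i) (?J j))" and ?Y' = "det_fun n (\<lambda>i j. a ((?I(r := p)) i) (?J j))"
    let ?Z = "det_fun n (\<lambda>i j. a (I (insert_index (Suc r) i)) (?J j))"
    let ?Z' = "det_fun m (\<lambda>i j. a ((I(r := p)) i) (J j))"
    have sm: "strict_mono_on {..<n} ?I" "strict_mono_on {..<n} ?J" "strict_mono_on {..<n} (\<lambda>i. I (insert_index (Suc r) i))"
      using I(1) J(1) unfolding m by (simp_all add: strict_mono_on_delete)
    have mem: "?I i \<in> U" "?J i \<in> V" "I (insert_index (Suc r) i) \<in> U" "?I i \<noteq> p" if "i < n" for i
      using that I(2) J(2) m no by (auto simp: insert_index_def)
    \<comment> \<open>Deleting row \<open>r\<close> moves row \<open>Suc p\<close> to position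
      \<open>r\<close>.\<close>
    have IH: "a (Suc p) k * ?Y' \<le> a p k * ?Y"
      by (rule Suc.IH) (use sm mem s m in auto)
    have e1: "?del (?F(Suc r := ?q)) c = ?Y'"
      by (rule det_fun_cong) (auto simp: insert_index_def)
    \<comment> \<open>Copying row \<open>r\<close> over row \<open>Suc r\<close> and then deleting
      row \<open>r\<close> amounts to deleting row \<open>Suc r\<close>.\<close>
    have e2: "?del (?F(Suc r := ?F r)) c = ?Z"
      by (rule det_fun_cong) (auto simp: insert_index_def not_less le_less)
    have e3: "det_fun m (?F(r := ?q)) = ?Z'"
      by (rule det_fun_cong) auto
    \<comment> \<open>The unit row at column \<open>c\<close> turns the determinants containing it
      in the Pluecker relation into minors of size \<open>n\<close>, all with the same sign, which
      cancels.\<close>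
    let ?w = "\<lambda>c'. if c' = c then 1 else 0 :: real"
    have cofac: "det_fun m ((?F(Suc r := v))(r := ?w)) = (-1) ^ (r + c) * ?del (?F(Suc r := v)) c" for v
      unfolding m by (rule det_fun_row_unit) (use s m c in auto)
    have "?X * det_fun m (?F(r := ?w, Suc r := ?q))
        = det_fun m (?F(r := ?q)) * det_fun m (?F(r := ?w, Suc r := ?F r)) + det_fun m (?F(Suc r := ?q)) * det_fun m (?F(r := ?w))"
      by (rule det_fun_pluecker) (use s in auto)
    moreover have "?F(r := ?w, Suc r := v) = (?F(Suc r := v))(r := ?w)" for v
      by (auto simp: fun_eq_iff)
    moreover have "det_fun m (?F(r := ?w)) = (-1) ^ (r + c) * ?Y"
      unfolding m by (rule det_fun_row_unit) (use s m c in auto)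
    ultimately have "(-1) ^ (r + c) * (?X * ?Y') = (-1) ^ (r + c) * (?Z' * ?Z + ?X' * ?Y)"
      unfolding X'[symmetric] e3 by (simp only: cofac e1 e2) (simp add: algebra_simps)
    then have pl: "?X * ?Y' = ?Z' * ?Z + ?X' * ?Y"
      by simp
    have "strict_mono_on {..<m} (I(r := p))"
    proof (rule strict_mono_onI)
      fix i l assume "i \<in> {..<m}" "l \<in> {..<m}" "i < l"
      then show "(I(r := p)) i < (I(r := p)) l"
        using earlier[of i] later[of l] s strict_mono_onD[OF I(1), of i l]
        by (cases "l = Suc r") auto
    qed
    then have "0 \<le> ?Z'"
      by (rule tn_onD[OF tn_on _ J(1)]) (use I J p in auto)
    moreover have "0 \<le> ?Z"
      by (rule tn_onD[OF tn_on sm(3,2)]) (use mem in auto)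
    ultimately have *: "?X' * ?Y \<le> ?X * ?Y'"
      using pl by simp
    have "strict_mono_on {..<n} (\<lambda>i. (I(Suc r := p)) (insert_index r i))"
      using mI' unfolding m by (rule strict_mono_on_delete)
    moreover have "(\<lambda>i. (I(Suc r := p)) (insert_index r i)) = ?I(r := p)"
      by (auto simp: fun_eq_iff insert_index_def)
    ultimately have mI: "strict_mono_on {..<n} (?I(r := p))"
      by simp
    have "0 \<le> ?Y'"
      by (rule tn_onD[OF tn_on mI sm(2)]) (use mem p in auto)
    then have Y': "0 < ?Y'" using c(2) e1 by simp
    \<comment> \<open>The induction hypothesis and \<open>?X' * ?Y \<le> ?X * ?Y'\<close> together
      eliminate \<open>?Y\<close>; the positive factor \<open>?Y'\<close> then cancels.\<close>
    have "a (Suc p) k * ?X' * ?Y' \<le> ?X' * (a p k * ?Y)"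
      using mult_left_mono[OF IH X'0] by (simp add: mult_ac)
    also have "\<dots> \<le> a p k * (?X * ?Y')"
      using mult_left_mono[OF * a0(1)] by (simp add: mult_ac)
    finally have "(a (Suc p) k * ?X') * ?Y' \<le> (a p k * ?X) * ?Y'"
      by (simp add: mult_ac)
    then show ?thesis using Y' by simp
  qed
qed


text \<open>The elimination inequality, divided by \<open>a p k\<close>, compares the two minors
  left by \<open>tn_on_row_comb\<close>. If row \<open>p\<close> is selected as well, the second
  minor has equal rows; if \<open>a p k = 0\<close>, the quotient is \<open>0\<close>.\<close>

lemma tn_on_eliminate_row:
  assumes tn_on: "tn_on U V a"
    and k: "k \<in> V" "\<And>v. v \<in> V \<Longrightarrow> k \<le> v" and p: "p \<in> U"
    and zero: "\<And>n. n \<in> U \<Longrightarrow> Suc p < n \<Longrightarrow> a n k = 0"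
  shows "tn_on U V (a(Suc p := (\<lambda>j. a (Suc p) j - a (Suc p) k / a p k * a p j)))"
proof -
  have "tn_on U V (a(Suc p := (\<lambda>j. a (Suc p) j + (- (a (Suc p) k / a p k)) * a p j)))"
  proof (rule tn_on_row_comb[OF tn_on])
    fix m s and I J :: "nat \<Rightarrow> nat"
    assume *: "strict_mono_on {..<m} I" "strict_mono_on {..<m} J"
      "\<And>i. i < m \<Longrightarrow> I i \<in> U" "\<And>j. j < m \<Longrightarrow> J j \<in> V" and s: "s < m" "I s = Suc p"
    let ?D = "det_fun m (\<lambda>i j. a (I i) (J j))" and ?D' = "det_fun m (\<lambda>l j. a ((I(s := p)) l) (J j))"
    have D: "0 \<le> ?D" by (rule tn_onD[OF tn_on]) (use * in auto)
    have "a (Suc p) k / a p k * ?D' \<le> ?D"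
    proof (cases "a p k = 0 \<or> (\<exists>i<m. I i = p)")
      case True
      then show ?thesis
      proof
        assume "\<exists>i<m. I i = p"
        then obtain i where "i < m" "I i = p" by blast
        then have "?D' = 0"
          by (intro det_fun_identical_rows[of i m s]) (use s in auto)
        then show ?thesis using D by simp
      qed (use D in simp)
    next
      case False
      then have "a (Suc p) k * ?D' \<le> a p k * ?D"
        by (intro tn_on_elimination_minor[OF tn_on k p zero]) (use * s in auto)
      moreover have "0 < a p k"
        using False tn_on_entry_nonneg[OF tn_on p k(1)] by simp
      ultimately show ?thesis by (simp add: field_simps)
    qed
    then show "0 \<le> ?D + (- (a (Suc p) k / a p k)) * ?D'" by simp
  qed
  then show ?thesis by simp
qed

text \<open>
  Since \<open>x / 0 = 0\<close>, a row below a zero entry of column \<open>k\<close> is left unchanged; under total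
  nonnegativity it has a zero there as well. Rows \<open>n \<le> k\<close> are irrelevant after this step.
\<close>
definition eliminate :: "nat \<Rightarrow> (nat \<Rightarrow> nat \<Rightarrow> real) \<Rightarrow> nat \<Rightarrow> nat \<Rightarrow> real" where
  "eliminate k a n j = (if n \<le> k then a n j else a n j - a n k / a (n - 1) k * a (n - 1) j)"

text \<open>Row \<open>n\<close> is changed by the original row \<open>n - 1\<close>, so rows are
  processed from the bottom up: when row \<open>Suc p\<close> is reached, row \<open>p\<close> is
  still unchanged and column \<open>k\<close> is already zero further down.\<close>

lemma tn_on_eliminate:
  assumes tn_on: "tn_on {k..D} V a" and k: "k \<in> V" "\<And>v. v \<in> V \<Longrightarrow> k \<le> v"
    and zero: "\<And>n. k \<le> n \<Longrightarrow> n < D \<Longrightarrow> a n k = 0 \<Longrightarrow> a (Suc n) k = 0"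
  shows "tn_on {k..D} V (eliminate k a)"
proof (cases "k \<le> D")
  case True
  have "tn_on {k..D} V (\<lambda>n. if n \<le> p then a n else eliminate k a n)" if "k \<le> p" "p \<le> D" for p
    using that(2,1)
  proof (induction p rule: inc_induct)
    case base
    have "tn_on {k..D} V (\<lambda>n. if n \<le> D then a n else eliminate k a n) = tn_on {k..D} V a"
      by (rule tn_on_cong) auto
    then show ?case using tn_on by simp
  next
    case (step p)
    let ?b = "\<lambda>n. if n \<le> Suc p then a n else eliminate k a n"
    have "tn_on {k..D} V (?b(Suc p := (\<lambda>j. ?b (Suc p) j - ?b (Suc p) k / ?b p k * ?b p j)))"
    proof (rule tn_on_eliminate_row)
      fix n assume n: "n \<in> {k..D}" "Suc p < n"
      \<comment> \<open>With a zero pivot the row is left alone, hence its entry in column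
        \<open>k\<close> has to be zero already.\<close>
      then have "a (n - 1) k = 0 \<Longrightarrow> a n k = 0"
        using zero[of "n - 1"] step by simp
      then show "?b n k = 0"
        using n step by (auto simp: eliminate_def)
    qed (use step k in auto)
    also have "?b(Suc p := (\<lambda>j. ?b (Suc p) j - ?b (Suc p) k / ?b p k * ?b p j))
      = (\<lambda>n. if n \<le> p then a n else eliminate k a n)"
      using step by (auto simp: fun_eq_iff eliminate_def)
    finally show ?case .
  qed
  from this[of k] True show ?thesis
    by (auto simp: eliminate_def[abs_def] cong: if_cong elim!: back_subst[of "tn_on {k..D} V"])
next
  case False
  then show ?thesis
    by (auto intro!: tn_onI) (metis atLeastatMost_empty_iff2 det_fun_0 empty_iff not_gr0 zero_le_one)
qed

subsection \<open>Resolutions of totally nonnegative arrays\<close>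

definition unitriangular :: "enat \<Rightarrow> (nat \<Rightarrow> nat \<Rightarrow> real) \<Rightarrow> bool" where
  "unitriangular N a \<longleftrightarrow> (\<forall>n. enat n \<le> N \<longrightarrow> a n n = 1 \<and> (\<forall>j>n. a n j = 0))"

lemma totally_nonneg_iff_tn_on: "totally_nonneg N a \<longleftrightarrow> tn_on {n. enat n \<le> N} {n. enat n \<le> N} a"
proof -
  have "(\<forall>i<m. enat (I i) \<le> N \<and> enat (J i) \<le> N) \<longleftrightarrow>
      I ` {..<m} \<subseteq> {n. enat n \<le> N} \<and> J ` {..<m} \<subseteq> {n. enat n \<le> N}" for m :: nat and I J
    by auto
  then show ?thesis
    by (simp only: totally_nonneg_def tn_on_def det_fun_def)
qed

lemma tn_on_empty: "tn_on {} V a"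
proof (rule tn_onI)
  fix m and I J :: "nat \<Rightarrow> nat"
  assume "\<And>i. i < m \<Longrightarrow> I i \<in> {}"
  then have "m = 0" by auto
  then show "0 \<le> det_fun m (\<lambda>i j. a (I i) (J j))" by simp
qed

text \<open>A minor has a last row, so infinitely many rows reduce to finitely many, where
  processing from the bottom makes sense.\<close>

lemma tn_on_initial_rows:
  assumes "\<And>D. enat D \<le> N \<Longrightarrow> tn_on {k..D} V a"
  shows "tn_on {n. k \<le> n \<and> enat n \<le> N} V a"
proof (rule tn_onI)
  fix m and I J :: "nat \<Rightarrow> nat"
  assume *: "strict_mono_on {..<m} I" "strict_mono_on {..<m} J"
    "\<And>i. i < m \<Longrightarrow> I i \<in> {n. k \<le> n \<and> enat n \<le> N}" "\<And>j. j < m \<Longrightarrow> J j \<in> V"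
  show "0 \<le> det_fun m (\<lambda>i j. a (I i) (J j))"
  proof (cases m)
    case (Suc n)
    have "I i \<le> I n" if "i < m" for i
      using strict_mono_onD[OF *(1), of i n] that Suc by (cases "i = n") auto
    then show ?thesis
      by (intro tn_onD[OF assms[of "I n"]]) (use * Suc in auto)
  qed simp
qed

text \<open>Row \<open>n \<ge> k\<close> of \<open>reduced a k\<close> becomes the coefficient
  sequence of \<open>R n k\<close>.\<close>

primrec reduced :: "(nat \<Rightarrow> nat \<Rightarrow> real) \<Rightarrow> nat \<Rightarrow> nat \<Rightarrow> nat \<Rightarrow> real" where
  "reduced a 0 = a"
| "reduced a (Suc k) = eliminate k (reduced a k)"

text \<open>The row subtracted from row \<open>n\<close> ends in column \<open>n - 1\<close>, so
  nothing from the diagonal on is affected.\<close>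

lemma reduced_diag:
  assumes "unitriangular N a" "enat n \<le> N" "k \<le> n"
  shows "reduced a k n n = 1" and "n < j \<Longrightarrow> reduced a k n j = 0"
proof -
  have "reduced a k n n = 1 \<and> (\<forall>j>n. reduced a k n j = 0)"
    using assms(2,3)
  proof (induction k arbitrary: n)
    case 0
    then show ?case using assms(1) by (simp add: unitriangular_def)
  next
    case (Suc k)
    have "enat (n - 1) \<le> N"
      using Suc.prems by (meson diff_le_self enat_ord_simps(1) order_trans)
    with Suc.IH[of n] Suc.IH[of "n - 1"] Suc.prems show ?case
      by (auto simp: eliminate_def)
  qed
  then show "reduced a k n n = 1" "n < j \<Longrightarrow> reduced a k n j = 0" by blast+
qed

text \<open>The second claim follows from the first and feeds the next elimination step. A zero
  passes down column \<open>k\<close> because of the minor with rows \<open>n\<close>,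
  \<open>Suc n\<close> and columns \<open>k\<close>, \<open>n\<close>, whose entry at
  \<open>(n, n)\<close> is \<open>1\<close>.\<close>

lemma reduced_tn_on:
  assumes "totally_nonneg N a" "unitriangular N a"
  shows "tn_on {n. k \<le> n \<and> enat n \<le> N} {n. k \<le> n \<and> enat n \<le> N} (reduced a k)"
    and "\<lbrakk>k \<le> n; enat (Suc n) \<le> N; reduced a k n k = 0\<rbrakk> \<Longrightarrow> reduced a k (Suc n) k = 0"
proof -
  let ?W = "\<lambda>k. {n. k \<le> n \<and> enat n \<le> N}"
  have van: "reduced a k (Suc n) k = 0"
    if tn_on: "tn_on (?W k) (?W k) (reduced a k)" and n: "k \<le> n" "enat (Suc n) \<le> N" "reduced a k n k = 0" for n k
  proof -
    have n': "enat n \<le> N"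
      using n(2) by (meson enat_ord_simps(1) le_SucI order_refl order_trans)
    \<comment> \<open>The diagonal entry \<open>1\<close> excludes \<open>n = k\<close>, so the
      minor has two distinct columns.\<close>
    have "k < n"
      using n n' reduced_diag(1)[OF assms(2) n' n(1)] by (cases "k = n") auto
    then have "reduced a k n n * reduced a k (Suc n) k \<le> reduced a k n k * reduced a k (Suc n) n"
      using n n' order_trans[OF _ n', of "enat k"] by (intro tn_on_minor2[OF tn_on]) auto
    then have "reduced a k (Suc n) k \<le> 0"
      using n reduced_diag(1)[OF assms(2) n' n(1)] by simp
    moreover have "0 \<le> reduced a k (Suc n) k"
      using n n' order_trans[OF _ n', of "enat k"] by (intro tn_on_entry_nonneg[OF tn_on]) auto
    ultimately show ?thesis by simp
  qed
  have tn_on: "tn_on (?W k) (?W k) (reduced a k)" for k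
  proof (induction k)
    case 0
    then show ?case using assms(1) by (simp add: totally_nonneg_iff_tn_on)
  next
    case (Suc k)
    have "tn_on (?W k) (?W k) (reduced a (Suc k))"
    proof (cases "enat k \<le> N")
      case True
      have "tn_on {k..D} (?W k) (reduced a (Suc k))" if D: "enat D \<le> N" for D
        unfolding reduced.simps
      proof (rule tn_on_eliminate)
        show "tn_on {k..D} (?W k) (reduced a k)"
          using order_trans[OF _ D] by (intro tn_on_subset[OF Suc]) auto
        fix n assume "k \<le> n" "n < D" "reduced a k n k = 0"
        moreover from this have "enat (Suc n) \<le> N"
          using order_trans[OF _ D, of "enat (Suc n)"] by simp
        ultimately show "reduced a k (Suc n) k = 0"
          using van[OF Suc] by blast
      qed (use True in auto)
      then show ?thesis by (rule tn_on_initial_rows)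
    next
      case False
      then have "?W k = {}"
        using order_trans[of "enat k" _ N] by fastforce
      then show ?thesis by (simp only: tn_on_empty)
    qed
    then show ?case by (rule tn_on_subset) auto
  qed
  then show "tn_on (?W k) (?W k) (reduced a k)" .
  show "\<lbrakk>k \<le> n; enat (Suc n) \<le> N; reduced a k n k = 0\<rbrakk> \<Longrightarrow> reduced a k (Suc n) k = 0"
    using van[OF tn_on] by blast
qed

lemma reduced_below:
  assumes "totally_nonneg N a" "unitriangular N a" "enat n \<le> N" "k \<le> n" "j < k"
  shows "reduced a k n j = 0"
  using assms(3-5)
proof (induction k arbitrary: n)
  case (Suc k)
  obtain p where n: "n = Suc p" using Suc.prems by (cases n) auto
  have p: "enat p \<le> N"
    using order_trans[OF _ Suc.prems(1), of "enat p"] n by simp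
  show ?case
  proof (cases "j = k")
    case True
    then show ?thesis
      using reduced_tn_on(2)[OF assms(1,2), of k p] Suc.prems n by (auto simp: eliminate_def)
  next
    case False
    then show ?thesis
      using Suc.IH[of n] Suc.IH[of p] Suc.prems n p by (auto simp: eliminate_def)
  qed
qed simp

lemma coeff_sum_monom: "coeff (\<Sum>j\<le>n. monom (c j) j) i = (if i \<le> n then c i else (0 :: real))"
  by (simp add: coeff_sum)

lemma resolves_exists:
  assumes "totally_nonneg N a" "unitriangular N a"
  shows "\<exists>l R. resolves N a l R \<and> (\<forall>n k. \<not> (k \<le> n \<and> enat n \<le> N) \<longrightarrow> R n k = 0)"
proof -
  \<comment> \<open>The value \<open>0\<close> outside the index range is the convention of
    \<open>R_polys\<close>.\<close>
  define R where "R = (\<lambda>n k. if k \<le> n \<and> enat n \<le> N then \<Sum>j\<le>n. monom (reduced a k n j) j else 0)"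
  \<comment> \<open>At a zero pivot the quotient is \<open>0\<close>, as the propagation of zero
    multipliers demands.\<close>
  define l where "l = (\<lambda>n k. reduced a k (Suc n) k / reduced a k n k)"
  have coeff_R: "coeff (R n k) j = reduced a k n j" if "k \<le> n" "enat n \<le> N" for n k j
    using that reduced_diag(2)[OF assms(2)] by (auto simp: R_def coeff_sum_monom)
  have Suc_le: "enat (Suc n) \<le> N" if "enat n < N" for n
    using that by (simp add: Suc_ile_eq)
  have deg: "degree (R n k) = n" if "k \<le> n" "enat n \<le> N" for n k
    using that reduced_diag[OF assms(2)]
    by (intro antisym degree_le le_degree) (auto simp: coeff_R)
  have "resolves N a l R"
    unfolding resolves_def
  proof (intro conjI allI impI; (elim conjE)?)
    fix n k assume n: "k \<le> n" "enat n < N"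
    then have "n \<in> {n. k \<le> n \<and> enat n \<le> N}" "Suc n \<in> {n. k \<le> n \<and> enat n \<le> N}" "k \<in> {n. k \<le> n \<and> enat n \<le> N}"
      using Suc_le[of n] order_trans[of "enat k" "enat n" N] by auto
    then show "0 \<le> l n k"
      unfolding l_def using tn_on_entry_nonneg[OF reduced_tn_on(1)[OF assms]] by auto
    show "R (Suc n) k = R (Suc n) (Suc k) + smult (l n k) (R n k)"
      using n Suc_le[of n] by (intro poly_eqI) (auto simp: coeff_R l_def eliminate_def)
  next
    fix n k assume "k \<le> n" "enat (Suc n) < N" "l n k = 0"
    \<comment> \<open>Whether numerator or denominator of \<open>l n k\<close> is zero, the pivot
      \<open>reduced a k (Suc n) k\<close> is zero, and it is the denominator of the next
      quotient.\<close>
    then show "l (Suc n) k = 0"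
      using reduced_tn_on(2)[OF assms, of k n] order_less_imp_le[of "enat (Suc n)" N] by (auto simp: l_def)
  next
    fix n k assume "k \<le> n" "enat n \<le> N"
    then show "lead_coeff (R n k) = 1" "monom 1 k dvd R n k"
      using reduced_diag[OF assms(2)] reduced_below[OF assms] by (auto simp: deg coeff_R monom_1_dvd_iff')
  next
    fix n assume n: "enat n \<le> N"
    then show "R n 0 = (\<Sum>k\<le>n. monom (a n k) k)"
      by (simp add: R_def)
    show "R n n = monom 1 n"
      using n reduced_diag[OF assms(2) n, of n] reduced_below[OF assms n, of n]
      by (intro poly_eqI) (simp add: coeff_R, metis linorder_neqE_nat order_refl)
  qed
  then show ?thesis
    unfolding R_def by (intro exI conjI) auto
qed

section \<open>Uniqueness of resolutions\<close>

lemma resolvesD: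
  assumes "resolves N a l R"
  shows "\<lbrakk>k \<le> n; enat n < N\<rbrakk> \<Longrightarrow> 0 \<le> l n k"
    and "\<lbrakk>k \<le> n; enat (Suc n) < N; l n k = 0\<rbrakk> \<Longrightarrow> l (Suc n) k = 0"
    and "\<lbrakk>k \<le> n; enat n \<le> N\<rbrakk> \<Longrightarrow> monom 1 k dvd R n k"
    and "enat n \<le> N \<Longrightarrow> R n 0 = (\<Sum>k\<le>n. monom (a n k) k)"
    and "enat n \<le> N \<Longrightarrow> R n n = monom 1 n"
    and "\<lbrakk>k \<le> n; enat n < N\<rbrakk> \<Longrightarrow> R (Suc n) k = R (Suc n) (Suc k) + smult (l n k) (R n k)"
proof -
  note * = assms[unfolded resolves_def]
  show "\<lbrakk>k \<le> n; enat n < N\<rbrakk> \<Longrightarrow> 0 \<le> l n k"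
    using *[THEN conjunct1] by blast
  show "\<lbrakk>k \<le> n; enat (Suc n) < N; l n k = 0\<rbrakk> \<Longrightarrow> l (Suc n) k = 0"
    using *[THEN conjunct2, THEN conjunct1] by blast
  show "\<lbrakk>k \<le> n; enat n \<le> N\<rbrakk> \<Longrightarrow> monom 1 k dvd R n k"
    using *[THEN conjunct2, THEN conjunct2, THEN conjunct1] by blast
  show "enat n \<le> N \<Longrightarrow> R n 0 = (\<Sum>k\<le>n. monom (a n k) k)" "enat n \<le> N \<Longrightarrow> R n n = monom 1 n"
    using *[THEN conjunct2, THEN conjunct2, THEN conjunct2, THEN conjunct1] by blast+
  show "\<lbrakk>k \<le> n; enat n < N\<rbrakk> \<Longrightarrow> R (Suc n) k = R (Suc n) (Suc k) + smult (l n k) (R n k)"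
    using *[THEN conjunct2, THEN conjunct2, THEN conjunct2, THEN conjunct2] by blast
qed

lemma resolves_mono: "resolves N a l R \<Longrightarrow> M \<le> N \<Longrightarrow> resolves M a l R"
  unfolding resolves_def
  by (elim conjE, intro conjI) (metis order_less_le_trans order_trans)+

lemma resolves_cong:
  assumes "resolves N a l R" "\<And>n k. enat n \<le> N \<Longrightarrow> a n k = b n k"
  shows "resolves N b l R"
  using assms by (simp add: resolves_def)

lemma resolves_coeff_below:
  "\<lbrakk>resolves N a l R; k \<le> n; enat n \<le> N; j < k\<rbrakk> \<Longrightarrow> coeff (R n k) j = 0"
  using resolvesD(3) by (fastforce simp: monom_1_dvd_iff')

text \<open>The degree bound starts from \<open>R n 0\<close> and is passed on by the recurrence
  solved for \<open>R n (Suc k)\<close>.\<close>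

lemma resolves_coeff_above:
  assumes "resolves N a l R" "k \<le> n" "enat n \<le> N" "n < j"
  shows "coeff (R n k) j = 0"
  using assms(2-4)
proof (induction k arbitrary: n)
  case 0
  then show ?case by (simp add: resolvesD(4)[OF assms(1)] coeff_sum_monom)
next
  case (Suc k)
  obtain p where n: "n = Suc p" using Suc.prems by (cases n) auto
  have "enat p < N" using Suc.prems n by (simp add: Suc_ile_eq)
  then have "R n k = R n (Suc k) + smult (l p k) (R p k)"
    using resolvesD(6)[OF assms(1), of k p] Suc.prems n by simp
  with Suc.IH[of n] Suc.IH[of p] Suc.prems n \<open>enat p < N\<close> show ?case by auto
qed

text \<open>At a zero pivot \<open>coeff (R n k) k\<close>, the coefficient of \<open>t^k\<close> in
  the recurrence does not determine the multiplier; the propagation rule does. A zero pivot comes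
  from a zero multiplier or a zero pivot one row above, and the first pivot is
  \<open>1\<close>.\<close>

lemma resolves_multiplier_zero:
  assumes "resolves N a l R" "k \<le> n" "enat n < N" "coeff (R n k) k = 0"
  shows "l n k = 0"
  using assms(2-4)
proof (induction n rule: dec_induct)
  case base
  then show ?case using resolvesD(5)[OF assms(1), of k] by simp
next
  case (step n)
  have n: "enat n < N" "enat (Suc n) \<le> N"
    using order_le_less_trans[of "enat n" "enat (Suc n)" N] step.prems(1) by auto
  have "coeff (R (Suc n) k) k = l n k * coeff (R n k) k"
    using resolvesD(6)[OF assms(1) step.hyps(1) n(1)]
      resolves_coeff_below[OF assms(1), of "Suc k" "Suc n" k] step.hyps n by simp
  then have "l n k = 0 \<or> coeff (R n k) k = 0"
    using step.prems(2) by simp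
  then have "l n k = 0"
    using step.IH[OF n(1)] by blast
  then show ?case
    by (rule resolvesD(2)[OF assms(1) step.hyps(1) step.prems(1)])
qed

text \<open>Taking the coefficient of \<open>t^k\<close> in the recurrence removes the
  \<open>Suc k\<close> term and so determines the multiplier, unless the pivot is zero, where both
  multipliers vanish.\<close>

lemma resolves_unique:
  assumes R: "resolves N a l R" and R': "resolves N a' l' R'"
    and eq: "\<And>n k. \<lbrakk>k \<le> n; enat n \<le> N\<rbrakk> \<Longrightarrow> a n k = a' n k"
    and "k \<le> n" "enat n \<le> N"
  shows "R n k = R' n k"
  using assms(4,5)
proof (induction k arbitrary: n)
  case 0
  then show ?case
    by (simp add: resolvesD(4)[OF R] resolvesD(4)[OF R'] eq)
next
  case (Suc k)
  obtain p where n: "n = Suc p" using Suc.prems by (cases n) auto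
  have p: "enat p < N" using Suc.prems n by (simp add: Suc_ile_eq)
  have kp: "k \<le> p" using Suc.prems n by simp
  have same: "R n k = R' n k" "R p k = R' p k"
    using Suc.IH[of n] Suc.IH[of p] Suc.prems n p by auto
  have rec: "R n k = R n (Suc k) + smult (l p k) (R p k)"
    "R' n k = R' n (Suc k) + smult (l' p k) (R' p k)"
    using resolvesD(6)[OF R kp p] resolvesD(6)[OF R' kp p] n by auto
  have "coeff (R n (Suc k)) k = 0" "coeff (R' n (Suc k)) k = 0"
    using resolves_coeff_below[OF R Suc.prems] resolves_coeff_below[OF R' Suc.prems] by auto
  then have "l p k * coeff (R p k) k = l' p k * coeff (R p k) k"
    using arg_cong[OF rec(1), of "\<lambda>q. coeff q k"] arg_cong[OF rec(2), of "\<lambda>q. coeff q k"] same by auto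
  then have "l p k = l' p k"
    using resolves_multiplier_zero[OF R kp p] resolves_multiplier_zero[OF R' kp p] same(2)
    by (cases "coeff (R p k) k = 0") auto
  then show ?case using rec same by simp
qed

text \<open>Existence, uniqueness within the index range and the value \<open>0\<close> outside it
  justify the definite description.\<close>

lemma resolves_R_polys:
  assumes "totally_nonneg N a" "unitriangular N a"
  shows "\<exists>l. resolves N a l (R_polys N a)"
proof -
  let ?P = "\<lambda>R. (\<exists>l. resolves N a l R) \<and> (\<forall>n k. \<not> (k \<le> n \<and> enat n \<le> N) \<longrightarrow> R n k = 0)"
  obtain R where R: "?P R" using resolves_exists[OF assms] by blast
  then obtain l where l: "resolves N a l R" by blast
  have "R' = R" if R': "?P R'" for R'
  proof (intro ext)
    fix n k
    obtain l' where "resolves N a l' R'" using R' by blast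
    with l have "R' n k = R n k" if "k \<le> n" "enat n \<le> N"
      using that by (intro resolves_unique[of N a l' R' a l R]) auto
    then show "R' n k = R n k"
      using R R' by metis
  qed
  with R have "?P (THE R. ?P R)"
    by (rule theI)
  then show ?thesis
    unfolding R_polys_def by blast
qed

text \<open>
  The requirement that a zero multiplier propagates is absent on purpose: the multipliers of the
  appended row need not satisfy it.
\<close>
lemma tn_on_of_recurrence:
  fixes R :: "nat \<Rightarrow> nat \<Rightarrow> real poly"
  assumes l: "\<And>n k. \<lbrakk>k \<le> n; n < D\<rbrakk> \<Longrightarrow> 0 \<le> l n k"
    and dvd: "\<And>n k. \<lbrakk>k \<le> n; n \<le> D\<rbrakk> \<Longrightarrow> monom 1 k dvd R n k"
    and diag: "\<And>n. n \<le> D \<Longrightarrow> R n n = monom 1 n"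
    and rec: "\<And>n k. \<lbrakk>k \<le> n; n < D\<rbrakk> \<Longrightarrow> R (Suc n) k = R (Suc n) (Suc k) + smult (l n k) (R n k)"
    and "k \<le> Suc D"
  shows "tn_on {k..D} {k..} (\<lambda>n j. coeff (R n k) j)"
  using assms(5)
proof (induction k rule: inc_induct)
  case base
  show ?case by (simp add: tn_on_empty)
next
  case (step k)
  \<comment> \<open>At stage \<open>p\<close>, column \<open>k\<close> is restored in the rows up to
    \<open>p\<close>; later rows are still those of level \<open>Suc k\<close>.\<close>
  let ?c = "\<lambda>p n j. coeff (if n \<le> p then R n k else R n (Suc k)) j"
  \<comment> \<open>Initially only row \<open>k\<close>, which is \<open>t^k\<close>, is new, and
    the later rows are divisible by \<open>t^(k+1)\<close>: a block diagonal array.\<close>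
  have "tn_on (insert k {Suc k..D}) (insert k {Suc k..}) (?c k)"
  proof (rule tn_on_insert_unit)
    have "tn_on {Suc k..D} {Suc k..} (?c k) = tn_on {Suc k..D} {Suc k..} (\<lambda>n j. coeff (R n (Suc k)) j)"
      by (rule tn_on_cong) auto
    then show "tn_on {Suc k..D} {Suc k..} (?c k)" using step.IH by simp
    fix u assume "u \<in> {Suc k..D}"
    then show "?c k u k = 0"
      using dvd[of "Suc k" u] by (simp add: monom_1_dvd_iff')
  qed (use step.hyps diag[of k] in auto)
  moreover have "insert k {Suc k..D} = {k..D}" "insert k {Suc k..} = {k..}"
    using step.hyps by auto
  ultimately have base: "tn_on {k..D} {k..} (?c k)" by simp
  have "tn_on {k..D} {k..} (?c p)" if "k \<le> p" "p \<le> D" for p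
    using that
  proof (induction p rule: dec_induct)
    case base
    show ?case by fact
  next
    case (step p)
    \<comment> \<open>Row \<open>Suc p\<close> uses the restored row \<open>p\<close>, so rows are
      treated from the top down, opposite to elimination.\<close>
    have "tn_on {k..D} {k..} ((?c p)(Suc p := (\<lambda>j. ?c p (Suc p) j + l p k * ?c p p j)))"
      using step.hyps(1) step.prems step.IH l[of k p] by (intro tn_on_add_row) auto
    also have "(?c p)(Suc p := (\<lambda>j. ?c p (Suc p) j + l p k * ?c p p j)) = ?c (Suc p)"
      using step.hyps(1) step.prems rec[of k p] by (auto simp: fun_eq_iff)
    finally show ?case .
  qed
  from this[of D] have "tn_on {k..D} {k..} (?c D)" using step.hyps by simp
  also have "tn_on {k..D} {k..} (?c D) = tn_on {k..D} {k..} (\<lambda>n j. coeff (R n k) j)"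
    by (rule tn_on_cong) auto
  finally show ?case .
qed

section \<open>Selecting coefficients of a nonnegative combination\<close>

lemma selected_combination:
  assumes R: "resolves (enat d) a l R" and a: "unitriangular (enat d) a"
    and h: "\<And>k. k \<le> d \<Longrightarrow> 0 \<le> h k"
    and s: "strict_mono s" "s e \<le> d"
    and R': "resolves (enat e) (\<lambda>n k. a (s n) (s k)) l' R'"
  shows "\<exists>h'. (\<forall>k\<le>e. 0 \<le> h' k) \<and>
    (\<Sum>j\<le>e. monom (coeff (\<Sum>k\<le>d. smult (h k) (R d k)) (s j)) j) = (\<Sum>k\<le>e. smult (h' k) (R' e k))"
proof -
  let ?f = "\<Sum>k\<le>d. smult (h k) (R d k)"
  \<comment> \<open>The reduced forms of the appended row \<open>Suc d\<close> are tail sums of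
    \<open>f\<close> plus \<open>t^(d+1)\<close>: consecutive ones differ by \<open>h k\<close>
    times \<open>R d k\<close>, and the last is \<open>t^(d+1)\<close> alone.\<close>
  define Q where "Q = (\<lambda>n k. if n \<le> d then R n k
    else monom 1 (Suc d) + (\<Sum>i\<in>{k..d}. smult (h i) (R d i)))"
  have tn_on_Q: "tn_on {0..Suc d} {0..} (\<lambda>n j. coeff (Q n 0) j)"
  proof (rule tn_on_of_recurrence[where l = "\<lambda>n k. if n < d then l n k else h k"])
    fix n k assume n: "k \<le> n" "n < Suc d"
    show "0 \<le> (if n < d then l n k else h k)"
      using n h resolvesD(1)[OF R] by auto
    show "Q (Suc n) k = Q (Suc n) (Suc k) + smult (if n < d then l n k else h k) (Q n k)"
      using n resolvesD(6)[OF R, of k n]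
      by (cases "n < d") (auto simp: Q_def sum.atLeast_Suc_atMost less_Suc_eq)
  next
    fix n k assume "k \<le> n" "n \<le> Suc d"
    then show "monom 1 k dvd Q n k"
      using resolvesD(3)[OF R, of k n] resolves_coeff_below[OF R, of _ d]
      by (auto simp: Q_def monom_1_dvd_iff' coeff_sum intro!: sum.neutral)
  next
    fix n assume "n \<le> Suc d"
    then show "Q n n = monom 1 n"
      using resolvesD(5)[OF R, of n] by (auto simp: Q_def le_Suc_eq)
  qed simp
  \<comment> \<open>The value at \<open>Suc e\<close> is \<open>Suc d\<close>, the appended index;
    the linear continuation keeps \<open>t\<close> strictly increasing everywhere.\<close>
  define t where "t = (\<lambda>n. if n \<le> e then s n else d + n - e)"
  have t_mono: "t n < t n'" if "n < n'" for n n'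
    using that s(2) strict_monoD[OF s(1), of n e] strict_monoD[OF s(1), of n n']
    by (cases "n = e") (auto simp: t_def)
  have t_le: "t n \<le> d" if "n \<le> e" for n
    using that s(2) strict_monoD[OF s(1), of n e] by (cases "n = e") (auto simp: t_def)
  have t_e: "t (Suc e) = Suc d" by (simp add: t_def)
  define b where "b = (\<lambda>n k. coeff (Q (t n) 0) (t k))"
  have tn_on_b: "totally_nonneg (enat (Suc e)) b"
    unfolding totally_nonneg_iff_tn_on b_def
  proof (rule tn_on_comp[OF tn_on_Q])
    show "t ` {n. enat n \<le> enat (Suc e)} \<subseteq> {0..Suc d}"
      using t_le t_e by (auto simp: le_Suc_eq intro: le_SucI)
  qed (auto simp: strict_mono_on_def t_mono)
  have coeff_Q: "coeff (Q n 0) j = (if j \<le> n then a n j else 0)" if "n \<le> d" for n j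
    using that resolvesD(4)[OF R, of n] by (simp add: Q_def coeff_sum_monom)
  have coeff_top: "coeff (Q (Suc d) 0) j = (if j = Suc d then 1 else coeff ?f j)" for j
    using resolves_coeff_above[OF R, of _ d "Suc d"]
    by (auto simp: Q_def coeff_sum atLeast0AtMost intro!: sum.neutral)
  have coeff_f: "coeff ?f j = 0" if "d < j" for j
    using that resolves_coeff_above[OF R, of _ d j] by (auto simp: coeff_sum intro!: sum.neutral)
  have uni_b: "unitriangular (enat (Suc e)) b"
    unfolding unitriangular_def
  proof (intro allI impI conjI)
    fix n assume "enat n \<le> enat (Suc e)"
    then consider "n \<le> e" | "n = Suc e" by force
    then show "b n n = 1"
      by cases (use a t_le in \<open>auto simp: b_def coeff_Q coeff_top t_e unitriangular_def\<close>)
    fix j assume "n < j"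
    then have "t n < t j" by (rule t_mono)
    then show "b n j = 0"
      using \<open>enat n \<le> _\<close> t_le[of n] by (auto simp: b_def coeff_Q coeff_top coeff_f t_e le_Suc_eq)
  qed
  obtain m E where E: "resolves (enat (Suc e)) b m E"
    using resolves_exists[OF tn_on_b uni_b] by blast
  \<comment> \<open>The rows of \<open>b\<close> up to \<open>e\<close> form the selected submatrix
    of \<open>a\<close>, so uniqueness identifies their resolution with \<open>R'\<close>.\<close>
  have E_eq: "E n k = R' n k" if "k \<le> n" "n \<le> e" for n k
  proof (rule resolves_unique[OF resolves_mono[OF E] R'])
    fix n k assume n: "k \<le> n" "enat n \<le> enat e"
    then have "t k \<le> t n" using t_mono[of k n] by (cases "k = n") auto
    then show "b n k = a (s n) (s k)"
      using n t_le[of n] by (auto simp: b_def coeff_Q) (auto simp: t_def)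
  qed (use that in auto)
  \<comment> \<open>Unrolling the recurrence in the last row exhibits the multipliers
    \<open>m e k\<close> as the wanted coefficients.\<close>
  have "E (Suc e) 0 = E (Suc e) (Suc i) + (\<Sum>k\<le>i. smult (m e k) (R' e k))" if "i \<le> e" for i
    using that
  proof (induction i)
    case 0
    then show ?case using resolvesD(6)[OF E, of 0 e] E_eq by simp
  next
    case (Suc i)
    then show ?case using resolvesD(6)[OF E, of "Suc i" e] E_eq[of "Suc i" e] by simp
  qed
  from this[of e] have "E (Suc e) 0 = monom 1 (Suc e) + (\<Sum>k\<le>e. smult (m e k) (R' e k))"
    using resolvesD(5)[OF E, of "Suc e"] by simp
  moreover have "E (Suc e) 0 = (\<Sum>k\<le>Suc e. monom (b (Suc e) k) k)"
    using resolvesD(4)[OF E, of "Suc e"] by simp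
  moreover have "(\<Sum>k\<le>e. monom (b (Suc e) k) k) = (\<Sum>j\<le>e. monom (coeff ?f (s j)) j)"
  proof (rule sum.cong[OF refl])
    fix j assume "j \<in> {..e}"
    then have "t j = s j" "s j \<le> d"
      using t_le[of j] by (auto simp: t_def)
    then show "monom (b (Suc e) j) j = monom (coeff ?f (s j)) j"
      by (simp add: b_def t_e coeff_top)
  qed
  moreover have "b (Suc e) (Suc e) = 1"
    by (simp add: b_def t_e coeff_top)
  \<comment> \<open>The top term \<open>monom 1 (Suc e)\<close> occurs in both expressions for
    \<open>E (Suc e) 0\<close> and cancels.\<close>
  ultimately have "(\<Sum>j\<le>e. monom (coeff ?f (s j)) j) = (\<Sum>k\<le>e. smult (m e k) (R' e k))"
    by simp
  moreover have "\<forall>k\<le>e. 0 \<le> m e k"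
    using resolvesD(1)[OF E, of _ e] by simp
  ultimately show ?thesis by blast
qed

subsection \<open>Quasi-ranks and rank selection\<close>

text \<open>Along a chain \<open>g\<close> grows by at least one per step, which bounds lengths by
  \<open>g y\<close>; descending through \<open>pred\<close> gives a chain of that length. Used to
  read off quasi-ranks after rank selection.\<close>

lemma quasi_rank_eqI:
  fixes g :: "'a \<Rightarrow> nat"
  assumes mono: "\<And>x y. \<lbrakk>(x, y) \<in> r; x \<noteq> y\<rbrakk> \<Longrightarrow> g x < g y"
    and pred: "\<And>y. \<lbrakk>y \<in> Field r; 0 < g y\<rbrakk> \<Longrightarrow> \<exists>x. (x, y) \<in> r \<and> x \<noteq> y \<and> Suc (g x) = g y"
    and y: "y \<in> Field r"
  shows "finite (chain_lengths r y)" and "quasi_rank r y = g y"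
proof -
  have le: "k \<le> g y" if k: "k \<in> chain_lengths r y" for k
  proof -
    obtain c where c: "c k = y" "\<forall>i<k. (c i, c (Suc i)) \<in> r \<and> c i \<noteq> c (Suc i)"
      using k by (auto simp: chain_lengths_def)
    have "i \<le> g (c i)" if "i \<le> k" for i
      using that
    proof (induction i)
      case (Suc i)
      then have "g (c i) < g (c (Suc i))" using c(2) mono by auto
      then show ?case using Suc by simp
    qed simp
    then show ?thesis using c(1) by blast
  qed
  have "n \<in> chain_lengths r y" if "g y = n" "y \<in> Field r" for n y
    using that
  proof (induction n arbitrary: y)
    case 0
    then show ?case by (auto simp: chain_lengths_def)
  next
    case (Suc n)
    then obtain x where x: "(x, y) \<in> r" "x \<noteq> y" "g x = n" using pred[of y] by auto
    then have "x \<in> Field r" by (auto simp: Field_def)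
    then obtain c where "c n = x" "\<forall>i\<le>n. c i \<in> Field r" "\<forall>i<n. (c i, c (Suc i)) \<in> r \<and> c i \<noteq> c (Suc i)"
      using Suc.IH[OF x(3)] by (auto simp: chain_lengths_def)
    with x Suc.prems show ?case
      unfolding chain_lengths_def
      by (intro CollectI exI[of _ "c(Suc n := y)"]) (auto simp: less_Suc_eq le_Suc_eq)
  qed
  then have mem: "g y \<in> chain_lengths r y" using y by blast
  show fin: "finite (chain_lengths r y)"
    by (rule finite_subset[of _ "{..g y}"]) (use le in auto)
  show "quasi_rank r y = g y"
    unfolding quasi_rank_def using le mem fin by (intro Max_eqI) auto
qed

context
  fixes r :: "'a rel"
  assumes r: "quasi_ranked_poset r"
begin

lemma quasi_ranked_poset_order:
  shows "x \<in> Field r \<Longrightarrow> (x, x) \<in> r"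
    and "(x, y) \<in> r \<Longrightarrow> (y, z) \<in> r \<Longrightarrow> (x, z) \<in> r"
    and "(x, y) \<in> r \<Longrightarrow> (y, x) \<in> r \<Longrightarrow> x = y"
proof -
  have *: "Refl r" "trans r" "antisym r"
    using r by (simp_all add: quasi_ranked_poset_def order_on_defs)
  show "x \<in> Field r \<Longrightarrow> (x, x) \<in> r" using *(1) by (rule refl_onD)
  show "(x, y) \<in> r \<Longrightarrow> (y, z) \<in> r \<Longrightarrow> (x, z) \<in> r" using *(2) by (rule transD)
  show "(x, y) \<in> r \<Longrightarrow> (y, x) \<in> r \<Longrightarrow> x = y" using *(3) by (rule antisymD)
qed

lemma quasi_rank_max:
  assumes "x \<in> Field r"
  shows "quasi_rank r x \<in> chain_lengths r x" and "k \<in> chain_lengths r x \<Longrightarrow> k \<le> quasi_rank r x"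
proof -
  have fin: "finite (chain_lengths r x)"
    using r assms by (simp add: quasi_ranked_poset_def)
  have "0 \<in> chain_lengths r x"
    using assms by (auto simp: chain_lengths_def)
  then show "quasi_rank r x \<in> chain_lengths r x"
    unfolding quasi_rank_def using fin by (intro Max_in) auto
  show "k \<in> chain_lengths r x \<Longrightarrow> k \<le> quasi_rank r x"
    unfolding quasi_rank_def using fin by simp
qed

lemma quasi_rank_strict:
  assumes "(x, y) \<in> r" "x \<noteq> y"
  shows "quasi_rank r x < quasi_rank r y"
proof -
  have F: "x \<in> Field r" "y \<in> Field r" using assms by (auto simp: Field_def)
  obtain c where "c (quasi_rank r x) = x" "\<forall>i\<le>quasi_rank r x. c i \<in> Field r"
    "\<forall>i<quasi_rank r x. (c i, c (Suc i)) \<in> r \<and> c i \<noteq> c (Suc i)"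
    using quasi_rank_max(1)[OF F(1)] by (auto simp: chain_lengths_def)
  with assms F have "Suc (quasi_rank r x) \<in> chain_lengths r y"
    unfolding chain_lengths_def
    by (intro CollectI exI[of _ "c(Suc (quasi_rank r x) := y)"]) (auto simp: less_Suc_eq le_Suc_eq)
  from quasi_rank_max(2)[OF F(2) this] show ?thesis by simp
qed

text \<open>The next to last element of a longest chain serves as \<open>x\<close>.\<close>

lemma quasi_rank_pred:
  assumes "y \<in> Field r" "0 < quasi_rank r y"
  shows "\<exists>x. (x, y) \<in> r \<and> x \<noteq> y \<and> Suc (quasi_rank r x) = quasi_rank r y"
proof -
  obtain n where n: "quasi_rank r y = Suc n" using assms by (cases "quasi_rank r y") auto
  obtain c where c: "c (Suc n) = y" "\<forall>i\<le>Suc n. c i \<in> Field r"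
    "\<forall>i<Suc n. (c i, c (Suc i)) \<in> r \<and> c i \<noteq> c (Suc i)"
    using quasi_rank_max(1)[OF assms(1)] n by (auto simp: chain_lengths_def)
  then have "n \<in> chain_lengths r (c n)"
    unfolding chain_lengths_def by (intro CollectI exI[of _ c]) auto
  then have "n \<le> quasi_rank r (c n)"
    using quasi_rank_max(2)[of "c n" n] c by simp
  moreover have "(c n, y) \<in> r" "c n \<noteq> y" using c by auto
  ultimately show ?thesis
    using quasi_rank_strict[of "c n" y] n by (intro exI[of _ "c n"]) auto
qed

lemma quasi_rank_below:
  assumes "y \<in> Field r" "k \<le> quasi_rank r y"
  shows "\<exists>x. (x, y) \<in> r \<and> quasi_rank r x = k"
  using assms(2)
proof (induction k rule: inc_induct)
  case base
  then show ?case using quasi_ranked_poset_order(1)[OF assms(1)] by blast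
next
  case (step k)
  then obtain x where x: "(x, y) \<in> r" "quasi_rank r x = Suc k" by blast
  then have "x \<in> Field r" by (auto simp: Field_def)
  then obtain w where "(w, x) \<in> r" "quasi_rank r w = k"
    using quasi_rank_pred[of x] x(2) by auto
  then show ?case using quasi_ranked_poset_order(2)[OF _ x(1)] by blast
qed

lemma obtain_least:
  obtains z where "z \<in> Field r" "\<And>x. x \<in> Field r \<Longrightarrow> (z, x) \<in> r" "quasi_rank r z = 0"
proof -
  obtain z where z: "z \<in> Field r" "\<forall>x\<in>Field r. (z, x) \<in> r"
    using r by (auto simp: quasi_ranked_poset_def has_least_def)
  have "quasi_rank r z = 0"
  proof (rule ccontr)
    assume "quasi_rank r z \<noteq> 0"
    then obtain x where x: "(x, z) \<in> r" "x \<noteq> z"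
      using quasi_rank_pred[OF z(1)] by auto
    then have "(z, x) \<in> r" using z(2) by (auto simp: Field_def)
    then show False using x quasi_ranked_poset_order(3) by blast
  qed
  with z show ?thesis using that by blast
qed

text \<open>The ideal below \<open>y\<close> is the interval from the least element to
  \<open>y\<close>.\<close>

lemma finite_under:
  assumes "y \<in> Field r"
  shows "finite (Order_Relation.under r y)"
proof -
  obtain z where z: "z \<in> Field r" "\<And>x. x \<in> Field r \<Longrightarrow> (z, x) \<in> r" using obtain_least by blast
  have "Order_Relation.under r y \<subseteq> {w. (z, w) \<in> r \<and> (w, y) \<in> r}"
    using z(2) by (auto simp: Order_Relation.under_def Field_def)
  moreover have "finite {w. (z, w) \<in> r \<and> (w, y) \<in> r}"
    using r z(1) assms by (simp add: quasi_ranked_poset_def locally_finite_rel_def)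
  ultimately show ?thesis by (rule finite_subset)
qed

lemma finite_level_below: "y \<in> Field r \<Longrightarrow> finite (level_below r y k)"
  using finite_under by (simp add: level_below_def)

lemma level_below_top:
  assumes "y \<in> Field r"
  shows "level_below r y (quasi_rank r y) = {y}" and "quasi_rank r y < k \<Longrightarrow> level_below r y k = {}"
  using quasi_rank_strict quasi_ranked_poset_order(1)[OF assms]
  by (force simp: level_below_def Order_Relation.under_def)+

text \<open>The ranks of elements form an initial segment of the naturals, so an infinite supremum
  causes no gap.\<close>

lemma le_poset_rank_iff: "enat n \<le> poset_rank r \<longleftrightarrow> (\<exists>x\<in>Field r. quasi_rank r x = n)"
proof
  assume n: "enat n \<le> poset_rank r"
  show "\<exists>x\<in>Field r. quasi_rank r x = n"
  proof (cases n)
    case 0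
    then show ?thesis using obtain_least by metis
  next
    case (Suc m)
    then have "enat m < poset_rank r" using n by (simp add: Suc_ile_eq)
    then obtain x where x: "x \<in> Field r" "m < quasi_rank r x"
      unfolding poset_rank_def by (auto simp: less_SUP_iff)
    then obtain w where "(w, x) \<in> r" "quasi_rank r w = n"
      using quasi_rank_below[of x n] Suc by auto
    then show ?thesis by (auto simp: Field_def)
  qed
next
  assume "\<exists>x\<in>Field r. quasi_rank r x = n"
  then show "enat n \<le> poset_rank r"
    unfolding poset_rank_def by (auto intro: SUP_upper2)
qed

lemma quasi_rank_le_poset_rank: "y \<in> Field r \<Longrightarrow> enat (quasi_rank r y) \<le> poset_rank r"
  using le_poset_rank_iff by blast

end

lemma quasi_rank_uniformD: "quasi_rank_uniform r \<Longrightarrow> quasi_ranked_poset r"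
  by (simp add: quasi_rank_uniform_def)

lemma rank_matrix_eq:
  assumes r: "quasi_rank_uniform r" and x: "x \<in> Field r"
  shows "rank_matrix r (quasi_rank r x) k = real (card (level_below r x k))"
proof -
  define y where "y = (SOME y. y \<in> Field r \<and> quasi_rank r y = quasi_rank r x)"
  have y: "y \<in> Field r" "quasi_rank r y = quasi_rank r x"
    using someI[of "\<lambda>y. y \<in> Field r \<and> quasi_rank r y = quasi_rank r x" x] x unfolding y_def by auto
  have "card (level_below r y k) = card (level_below r x k)"
  proof (cases "k \<le> quasi_rank r x")
    case True
    then show ?thesis using r x y unfolding quasi_rank_uniform_def by metis
  next
    \<comment> \<open>Uniformity speaks of \<open>k\<close> up to the rank; above it both levels are
      empty.\<close>
    case False
    then show ?thesis
      using level_below_top(2)[OF quasi_rank_uniformD[OF r], of _ k] x y by simp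
  qed
  then show ?thesis by (simp add: rank_matrix_def y_def)
qed

lemma unitriangular_rank_matrix:
  assumes r: "quasi_rank_uniform r"
  shows "unitriangular (poset_rank r) (rank_matrix r)"
  unfolding unitriangular_def
proof (intro allI impI)
  fix n assume "enat n \<le> poset_rank r"
  then obtain x where "x \<in> Field r" "quasi_rank r x = n"
    using le_poset_rank_iff[OF quasi_rank_uniformD[OF r]] by blast
  then show "rank_matrix r n n = 1 \<and> (\<forall>j>n. rank_matrix r n j = 0)"
    using rank_matrix_eq[OF r, of x] level_below_top[OF quasi_rank_uniformD[OF r], of x] by auto
qed

lemma coeff_rank_sum:
  assumes "finite F"
  shows "coeff (\<Sum>x\<in>F. monom 1 (g x)) k = real (card {x \<in> F. g x = k})"
  using assms by (simp add: coeff_sum sum.If_cases Collect_conj_eq Int_commute)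

text \<open>Comparing coefficients replaces the polynomial identity by level sizes, which are easy
  to follow under rank selection.\<close>

lemma combinatorial_poset_iff:
  assumes P: "TN_poset P" and Q: "quasi_rank_uniform Q" and le: "poset_rank Q \<le> poset_rank P"
  shows "combinatorial_poset P Q \<longleftrightarrow>
    (\<forall>y\<in>Field Q. \<forall>k. real (card (level_below Q y k)) = rank_matrix P (quasi_rank Q y) k)"
proof -
  note Q' = quasi_rank_uniformD[OF Q]
  have uni: "unitriangular (poset_rank P) (rank_matrix P)"
    using P by (simp add: TN_poset_def unitriangular_rank_matrix)
  obtain l where l: "resolves (poset_rank P) (rank_matrix P) l (poset_polys P)"
    using resolves_R_polys[OF _ uni] P by (auto simp: TN_poset_def)
  have "(\<Sum>x\<in>Order_Relation.under Q y. monom 1 (quasi_rank Q x)) = poset_polys P (quasi_rank Q y) 0 \<longleftrightarrow>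
      (\<forall>k. real (card (level_below Q y k)) = rank_matrix P (quasi_rank Q y) k)" if y: "y \<in> Field Q" for y
  proof -
    have n: "enat (quasi_rank Q y) \<le> poset_rank P"
      using quasi_rank_le_poset_rank[OF Q' y] le by (rule order_trans)
    have "coeff (poset_polys P (quasi_rank Q y) 0) k = rank_matrix P (quasi_rank Q y) k" for k
      unfolding resolvesD(4)[OF l n] coeff_sum_monom using uni n by (auto simp: unitriangular_def)
    moreover have "coeff (\<Sum>x\<in>Order_Relation.under Q y. monom 1 (quasi_rank Q x)) k
        = real (card (level_below Q y k))" for k
      unfolding level_below_def by (rule coeff_rank_sum[OF finite_under[OF Q' y]])
    ultimately show ?thesis by (simp add: poly_eq_iff)
  qed
  then show ?thesis
    using P Q le by (simp add: combinatorial_poset_def)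
qed

lemma enat_le_if_all_le:
  assumes "\<And>n. enat n \<le> A \<Longrightarrow> enat n \<le> B"
  shows "A \<le> B"
proof (cases B)
  case (enat b)
  with assms[of "Suc b"] have "A < enat (Suc b)" by (meson Suc_n_not_le_n enat_ord_simps(1) not_le)
  then obtain a where "A = enat a" by (cases A) auto
  then show ?thesis using assms by blast
qed simp

section \<open>Rank selection along the increasing enumeration \<open>s\<close> of
  \<open>S\<close>\<close>

context
  fixes r :: "'a rel" and s :: "nat \<Rightarrow> nat" and S :: "nat set"
  assumes r: "quasi_ranked_poset r"
    and s: "strict_mono s" "range s = S" "s 0 = 0"
begin

lemma Field_rank_selected: "Field (rank_selected r S) = {x \<in> Field r. quasi_rank r x \<in> S}"
  using quasi_ranked_poset_order(1)[OF r] by (auto simp: rank_selected_def Field_def)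

lemma mem_rank_selected:
  "(x, y) \<in> rank_selected r S \<longleftrightarrow> (x, y) \<in> r \<and> quasi_rank r x \<in> S \<and> quasi_rank r y \<in> S"
  by (auto simp: rank_selected_def Field_def)

text \<open>The position of the old rank in \<open>S\<close> meets the conditions of
  \<open>quasi_rank_eqI\<close>: below an element of rank \<open>s (Suc n)\<close> there is one of
  rank \<open>s n\<close>, since every smaller rank occurs in its principal ideal.\<close>

lemma quasi_rank_rank_selected:
  assumes "x \<in> Field (rank_selected r S)"
  shows "finite (chain_lengths (rank_selected r S) x)"
    and "s (quasi_rank (rank_selected r S) x) = quasi_rank r x"
proof -
  have inj: "inj s" using s(1) by (rule strict_mono_imp_inj_on)
  define g where "g = (\<lambda>x. the_inv s (quasi_rank r x))"
  have g: "s (g x) = quasi_rank r x" if "quasi_rank r x \<in> S" for x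
    unfolding g_def using that s(2) inj by (simp add: f_the_inv_into_f)
  have mono: "g x < g y" if xy: "(x, y) \<in> rank_selected r S" "x \<noteq> y" for x y
  proof -
    have "s (g x) < s (g y)"
      using xy quasi_rank_strict[OF r, of x y] g by (auto simp: mem_rank_selected)
    then show "g x < g y"
      using s(1) by (simp add: strict_mono_less)
  qed
  have pred: "\<exists>x. (x, y) \<in> rank_selected r S \<and> x \<noteq> y \<and> Suc (g x) = g y"
    if y: "y \<in> Field (rank_selected r S)" "0 < g y" for y
  proof -
    obtain n where n: "g y = Suc n" using y(2) by (cases "g y") auto
    have y': "y \<in> Field r" "quasi_rank r y \<in> S" "quasi_rank r y = s (Suc n)"
      using y g[of y] n by (auto simp: Field_rank_selected)
    have lt: "s n < s (Suc n)" using s(1) by (simp add: strict_mono_less)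
    then obtain x where x: "(x, y) \<in> r" "quasi_rank r x = s n"
      using quasi_rank_below[OF r y'(1), of "s n"] y'(3) by auto
    have "g x = n" unfolding g_def x(2) using inj by (rule the_inv_f_f)
    with x y' lt n show ?thesis
      using s(2) by (intro exI[of _ x]) (auto simp: mem_rank_selected)
  qed
  show "finite (chain_lengths (rank_selected r S) x)"
    using mono pred assms by (rule quasi_rank_eqI(1))
  have "quasi_rank (rank_selected r S) x = g x"
    using mono pred assms by (rule quasi_rank_eqI(2))
  then show "s (quasi_rank (rank_selected r S) x) = quasi_rank r x"
    using g[of x] assms by (simp add: Field_rank_selected)
qed

lemma quasi_ranked_poset_rank_selected: "quasi_ranked_poset (rank_selected r S)"
  unfolding quasi_ranked_poset_def
proof (intro conjI ballI)
  show "Partial_order (rank_selected r S)"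
    using r unfolding rank_selected_def quasi_ranked_poset_def by (simp add: Partial_order_Restr)
  obtain z where "z \<in> Field r" "\<And>x. x \<in> Field r \<Longrightarrow> (z, x) \<in> r" "quasi_rank r z = 0"
    using obtain_least[OF r] by blast
  moreover have "0 \<in> S" using s(2,3) by (metis rangeI)
  ultimately show "has_least (rank_selected r S)"
    unfolding has_least_def by (intro bexI[of _ z]) (auto simp: mem_rank_selected Field_rank_selected)
  show "locally_finite_rel (rank_selected r S)"
    unfolding locally_finite_rel_def
  proof (intro ballI)
    fix x y assume "x \<in> Field (rank_selected r S)" "y \<in> Field (rank_selected r S)"
    then have "finite {z. (x, z) \<in> r \<and> (z, y) \<in> r}"
      using r by (simp add: quasi_ranked_poset_def locally_finite_rel_def Field_rank_selected)
    then show "finite {z. (x, z) \<in> rank_selected r S \<and> (z, y) \<in> rank_selected r S}"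
      by (rule rev_finite_subset) (auto simp: mem_rank_selected)
  qed
qed (rule quasi_rank_rank_selected(1))

lemma quasi_rank_rank_selected_eq_iff:
  "x \<in> Field (rank_selected r S) \<Longrightarrow> quasi_rank (rank_selected r S) x = k \<longleftrightarrow> quasi_rank r x = s k"
  using quasi_rank_rank_selected(2)[of x] s(1) by (metis strict_mono_eq)

lemma level_below_rank_selected:
  assumes "x \<in> Field (rank_selected r S)"
  shows "level_below (rank_selected r S) x k = level_below r x (s k)"
proof -
  have "z \<in> Order_Relation.under (rank_selected r S) x \<and> quasi_rank (rank_selected r S) z = k \<longleftrightarrow>
      z \<in> Order_Relation.under r x \<and> quasi_rank r z = s k" (is "?L \<longleftrightarrow> ?R") for z
  proof -
    have "?L \<or> ?R \<Longrightarrow> (z, x) \<in> rank_selected r S"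
      using assms s(2) by (auto simp: Order_Relation.under_def mem_rank_selected Field_rank_selected)
    moreover from this have "?L \<or> ?R \<Longrightarrow> z \<in> Field (rank_selected r S)"
      by (blast intro: FieldI1)
    ultimately show ?thesis
      using quasi_rank_rank_selected_eq_iff[of z k]
      by (auto simp: Order_Relation.under_def mem_rank_selected)
  qed
  then show ?thesis by (auto simp: level_below_def)
qed

lemma le_poset_rank_rank_selected: "enat n \<le> poset_rank (rank_selected r S) \<longleftrightarrow> enat (s n) \<le> poset_rank r"
proof -
  have "s n \<in> S" using s(2) by blast
  then have "(\<exists>x\<in>Field (rank_selected r S). quasi_rank (rank_selected r S) x = n) \<longleftrightarrow>
      (\<exists>x\<in>Field r. quasi_rank r x = s n)"
    using quasi_rank_rank_selected_eq_iff by (auto simp: Field_rank_selected)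
  then show ?thesis
    by (simp add: le_poset_rank_iff[OF r] le_poset_rank_iff[OF quasi_ranked_poset_rank_selected])
qed

lemma quasi_rank_uniform_rank_selected:
  assumes "quasi_rank_uniform r"
  shows "quasi_rank_uniform (rank_selected r S)"
  unfolding quasi_rank_uniform_def
proof (intro conjI ballI allI impI)
  fix x y k assume x: "x \<in> Field (rank_selected r S)" and y: "y \<in> Field (rank_selected r S)"
    and eq: "quasi_rank (rank_selected r S) x = quasi_rank (rank_selected r S) y"
  have "quasi_rank r x = quasi_rank r y"
    using quasi_rank_rank_selected(2)[OF x] quasi_rank_rank_selected(2)[OF y] eq by simp
  then have "card (level_below r x (s k)) = card (level_below r y (s k))"
    using rank_matrix_eq[OF assms, of x "s k"] rank_matrix_eq[OF assms, of y "s k"] x y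
    by (simp add: Field_rank_selected)
  then show "card (level_below (rank_selected r S) x k) = card (level_below (rank_selected r S) y k)"
    by (simp add: level_below_rank_selected x y)
qed (simp_all add: quasi_ranked_poset_rank_selected finite_level_below)

lemma rank_matrix_rank_selected:
  assumes "quasi_rank_uniform r" "enat n \<le> poset_rank (rank_selected r S)"
  shows "rank_matrix (rank_selected r S) n k = rank_matrix r (s n) (s k)"
proof -
  obtain x where x: "x \<in> Field (rank_selected r S)" "quasi_rank (rank_selected r S) x = n"
    using assms(2) le_poset_rank_iff[OF quasi_ranked_poset_rank_selected] by blast
  then have "quasi_rank r x = s n" "x \<in> Field r"
    using quasi_rank_rank_selected_eq_iff by (auto simp: Field_rank_selected)
  then show ?thesis
    using rank_matrix_eq[OF assms(1), of x "s k"]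
      rank_matrix_eq[OF quasi_rank_uniform_rank_selected[OF assms(1)] x(1), of k] x
    by (simp add: level_below_rank_selected)
qed

lemma TN_poset_rank_selected:
  assumes "TN_poset r"
  shows "TN_poset (rank_selected r S)"
proof -
  have uni: "quasi_rank_uniform r" using assms by (simp add: TN_poset_def)
  let ?N = "{n. enat n \<le> poset_rank (rank_selected r S)}"
  have "tn_on ?N ?N (\<lambda>n k. rank_matrix r (s n) (s k))"
  proof (rule tn_on_comp)
    show "tn_on {n. enat n \<le> poset_rank r} {n. enat n \<le> poset_rank r} (rank_matrix r)"
      using assms by (simp add: TN_poset_def totally_nonneg_iff_tn_on)
    show "strict_mono_on ?N s" "strict_mono_on ?N s"
      using strict_monoD[OF s(1)] by (auto intro: strict_mono_onI)
    show "s ` ?N \<subseteq> {n. enat n \<le> poset_rank r}" "s ` ?N \<subseteq> {n. enat n \<le> poset_rank r}"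
      using le_poset_rank_rank_selected by auto
  qed
  moreover have "tn_on ?N ?N (\<lambda>n k. rank_matrix r (s n) (s k)) = tn_on ?N ?N (rank_matrix (rank_selected r S))"
    by (rule tn_on_cong) (simp add: rank_matrix_rank_selected[OF uni])
  ultimately show ?thesis
    by (simp add: TN_poset_def totally_nonneg_iff_tn_on quasi_rank_uniform_rank_selected[OF uni])
qed

end

text \<open>Selection reindexes the level sizes of \<open>Q\<close> and the entries of
  \<open>R(P)\<close> by the same \<open>s\<close>, so their agreement carries over.\<close>

lemma combinatorial_poset_rank_selected:
  fixes s :: "nat \<Rightarrow> nat"
  assumes PQ: "combinatorial_poset P Q" and s: "strict_mono s" "range s = S" "s 0 = 0"
  shows "combinatorial_poset (rank_selected P S) (rank_selected Q S)"
proof -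
  have P: "TN_poset P" "quasi_rank_uniform P" and Q: "quasi_rank_uniform Q" and le: "poset_rank Q \<le> poset_rank P"
    using PQ by (auto simp: combinatorial_poset_def TN_poset_def)
  note P' = quasi_rank_uniformD[OF P(2)] and Q' = quasi_rank_uniformD[OF Q]
  let ?P = "rank_selected P S" and ?Q = "rank_selected Q S"
  have le': "poset_rank ?Q \<le> poset_rank ?P"
  proof (rule enat_le_if_all_le)
    fix n assume "enat n \<le> poset_rank ?Q"
    then have "enat (s n) \<le> poset_rank Q"
      by (simp only: le_poset_rank_rank_selected[OF Q' s])
    then have "enat (s n) \<le> poset_rank P" using le by (rule order_trans)
    then show "enat n \<le> poset_rank ?P"
      by (simp only: le_poset_rank_rank_selected[OF P' s])
  qed
  have "real (card (level_below ?Q y k)) = rank_matrix ?P (quasi_rank ?Q y) k" if y: "y \<in> Field ?Q" for y k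
  proof -
    have "enat (quasi_rank ?Q y) \<le> poset_rank ?P"
      using quasi_rank_le_poset_rank[OF quasi_ranked_poset_rank_selected[OF Q' s] y] le'
      by (rule order_trans)
    then have "rank_matrix ?P (quasi_rank ?Q y) k = rank_matrix P (quasi_rank Q y) (s k)"
      by (simp add: rank_matrix_rank_selected[OF P' s P(2)] quasi_rank_rank_selected(2)[OF Q' s y])
    also have "\<dots> = real (card (level_below Q y (s k)))"
      using combinatorial_poset_iff[OF P(1) Q le] PQ y by (simp add: Field_rank_selected[OF Q' s])
    finally show ?thesis
      by (simp add: level_below_rank_selected[OF Q' s y])
  qed
  then show ?thesis
    using combinatorial_poset_iff[OF TN_poset_rank_selected[OF P' s P(1)]
        quasi_rank_uniform_rank_selected[OF Q' s Q] le'] by blast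
qed

lemma f_poly_rank_selected:
  fixes s :: "nat \<Rightarrow> nat"
  assumes Q: "quasi_ranked_poset Q" and s: "strict_mono s" "range s = S" "s 0 = 0"
    and fin: "finite (Field Q)" and e: "poset_rank (rank_selected Q S) = enat e"
  shows "f_poly (rank_selected Q S) = (\<Sum>j\<le>e. monom (coeff (f_poly Q) (s j)) j)"
proof (rule poly_eqI)
  fix j
  let ?Q = "rank_selected Q S"
  have finS: "finite (Field ?Q)" using fin by (simp add: Field_rank_selected[OF Q s])
  have "s j \<in> S" using s(2) by blast
  then have "{x \<in> Field ?Q. quasi_rank ?Q x = j} = {x \<in> Field Q. quasi_rank Q x = s j}"
    using quasi_rank_rank_selected_eq_iff[OF Q s] by (auto simp: Field_rank_selected[OF Q s])
  then have "coeff (f_poly ?Q) j = coeff (f_poly Q) (s j)"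
    by (simp add: f_poly_def coeff_rank_sum fin finS)
  \<comment> \<open>No element has rank above \<open>e\<close>, so cutting the sum off there loses
    nothing.\<close>
  moreover have "coeff (f_poly ?Q) j = 0" if "e < j"
  proof -
    have "{x \<in> Field ?Q. quasi_rank ?Q x = j} = {}"
      using le_poset_rank_iff[OF quasi_ranked_poset_rank_selected[OF Q s], of j] that e by auto
    then show ?thesis by (simp add: f_poly_def coeff_rank_sum finS)
  qed
  ultimately show "coeff (f_poly ?Q) j = coeff (\<Sum>j\<le>e. monom (coeff (f_poly Q) (s j)) j) j"
    by (auto simp: coeff_sum_monom)
qed

theorem theorem6p7:
  fixes P :: "'a rel" and Q :: "'b rel" and S :: "nat set"
  assumes "TN_poset P"
    and "infinite S" and "0 \<in> S"
    and "finite (Field Q)" and "poset_positive P Q"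
  shows "poset_positive (rank_selected P S) (rank_selected Q S)"
proof -
  \<comment> \<open>Since \<open>S\<close> is infinite, its enumeration is strictly increasing on
    all naturals; \<open>0 \<in> S\<close> makes it start at \<open>0\<close>, so the least elements
    survive.\<close>
  define s where "s = enumerate S"
  have s: "strict_mono s" "range s = S" "s 0 = 0"
    using assms(2,3) by (auto simp: s_def strict_mono_enumerate range_enumerate enumerate_0 intro: Least_eq_0)
  have comb: "combinatorial_poset P Q"
    using assms(5) by (simp add: poset_positive_def)
  obtain d h where d: "poset_rank Q = enat d" and h: "\<forall>k\<le>d. h k \<ge> (0 :: real)"
    and f: "f_poly Q = (\<Sum>k\<le>d. smult (h k) (poset_polys P d k))"
    using assms(5) by (auto simp: poset_positive_def)
  have P: "quasi_rank_uniform P" and Q: "quasi_rank_uniform Q" and le: "enat d \<le> poset_rank P"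
    using comb d by (auto simp: combinatorial_poset_def TN_poset_def)
  note P' = quasi_rank_uniformD[OF P] and Q' = quasi_rank_uniformD[OF Q]
  let ?P = "rank_selected P S" and ?Q = "rank_selected Q S"
  note combS = combinatorial_poset_rank_selected[OF comb s]
  have rankQ: "enat n \<le> poset_rank ?Q \<longleftrightarrow> s n \<le> d" for n
    using le_poset_rank_rank_selected[OF Q' s] d by simp
  \<comment> \<open>\<open>s (Suc d) \<ge> Suc d\<close> exceeds the rank of \<open>Q\<close>, so
    \<open>?Q\<close> has finite rank.\<close>
  have "\<not> enat (Suc d) \<le> poset_rank ?Q"
    using rankQ[of "Suc d"] strict_mono_imp_increasing[OF s(1), of "Suc d"] by simp
  then obtain e where e: "poset_rank ?Q = enat e"
    by (cases "poset_rank ?Q") auto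
  then have se: "s e \<le> d" using rankQ[of e] by simp
  have eP: "enat e \<le> poset_rank ?P"
    using combS e by (simp add: combinatorial_poset_def)
  have TNS: "TN_poset ?P"
    using combS by (simp add: combinatorial_poset_def)
  note uni = unitriangular_rank_matrix[OF P]
  obtain l where l: "resolves (poset_rank P) (rank_matrix P) l (poset_polys P)"
    using resolves_R_polys[OF _ uni] assms(1) by (auto simp: TN_poset_def)
  obtain l' where "resolves (poset_rank ?P) (rank_matrix ?P) l' (poset_polys ?P)"
    using resolves_R_polys[OF _ unitriangular_rank_matrix] TNS by (auto simp: TN_poset_def)
  \<comment> \<open>The rank of \<open>?P\<close> may be larger than \<open>e\<close>; the expansion
    sought for \<open>?Q\<close> concerns row \<open>e\<close> only.\<close>
  then have "resolves (enat e) (rank_matrix ?P) l' (poset_polys ?P)"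
    using eP by (rule resolves_mono)
  then have l': "resolves (enat e) (\<lambda>n k. rank_matrix P (s n) (s k)) l' (poset_polys ?P)"
  proof (rule resolves_cong)
    fix n k :: nat assume "enat n \<le> enat e"
    then have "enat n \<le> poset_rank ?P" using eP by (rule order_trans)
    then show "rank_matrix ?P n k = rank_matrix P (s n) (s k)"
      by (rule rank_matrix_rank_selected[OF P' s P])
  qed
  have "unitriangular (enat d) (rank_matrix P)"
    using uni le unfolding unitriangular_def by (meson order_trans)
  from selected_combination[OF resolves_mono[OF l le] this _ s(1) se l', of h] h
  obtain h' where "\<forall>k\<le>e. 0 \<le> h' k"
    "(\<Sum>j\<le>e. monom (coeff (f_poly Q) (s j)) j) = (\<Sum>k\<le>e. smult (h' k) (poset_polys ?P e k))"
    unfolding f by blast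
  then show ?thesis
    unfolding poset_positive_def
    using combS e f_poly_rank_selected[OF Q' s assms(4) e] assms(4)
    by (auto simp: Field_rank_selected[OF Q' s])
qed

end
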